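(* Let $(A,\mathfrak{m})$ be a Noetherian equicharacteristic local ring of dimension $d>0$, $M$ a maximal Cohen–Macaulay $A$-module, and $I$ an $\mathfrak{m}$-primary ideal with $\mu(I)=d+1$. Then the Hilbert function of $M$ with respect to $I$, $n\mapsto\lambda(I^nM/I^{n+1}M)$, is non-decreasing.
   Context: Equicharacteristic: $A$ and $A/\mathfrak{m}$ have the same characteristic. $\mu(I)$ is the minimal number of generators of $I$. MCM: $\operatorname{depth}M=\dim A$. *)

theory Defs
  imports Main "HOL-Library.Extended_Nat"
begin

text \<open>The ring A is the whole type 'a (a commutative ring with 1); the module M is the whole
  type 'm, with scalar multiplication sc, assumed to satisfy the module axioms.\<close>

definition is_ideal :: "'a::comm_ring_1 set \<Rightarrow> bool" where
  "is_ideal I \<longleftrightarrow> 0 \<in> I \<and> (\<forall>x\<in>I. \<forall>y\<in>I. x + y \<in> I) \<and> (\<forall>a. \<forall>x\<in>I. a * x \<in> I)"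

definition ideal_gen :: "'a::comm_ring_1 set \<Rightarrow> 'a set" where
  "ideal_gen S = module.span ((*)) S"

definition is_prime_ideal :: "'a::comm_ring_1 set \<Rightarrow> bool" where
  "is_prime_ideal P \<longleftrightarrow> is_ideal P \<and> P \<noteq> UNIV \<and> (\<forall>x y. x * y \<in> P \<longrightarrow> x \<in> P \<or> y \<in> P)"

definition is_maximal_ideal :: "'a::comm_ring_1 set \<Rightarrow> bool" where
  "is_maximal_ideal m \<longleftrightarrow> is_ideal m \<and> m \<noteq> UNIV \<and>
     (\<forall>J. is_ideal J \<and> m \<subseteq> J \<longrightarrow> J = m \<or> J = UNIV)"

definition noetherian_ring :: "'a::comm_ring_1 itself \<Rightarrow> bool" where
  "noetherian_ring _ \<longleftrightarrow> (\<forall>I::'a set. is_ideal I \<longrightarrow> (\<exists>S. finite S \<and> I = ideal_gen S))"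

definition local_ring :: "'a::comm_ring_1 set \<Rightarrow> bool" where
  "local_ring m \<longleftrightarrow> is_maximal_ideal m \<and> (\<forall>m'. is_maximal_ideal m' \<longrightarrow> m' = m)"

definition krull_dim :: "'a::comm_ring_1 itself \<Rightarrow> enat" where
  "krull_dim _ = Sup {enat n | n. \<exists>P :: nat \<Rightarrow> 'a set.
      (\<forall>i\<le>n. is_prime_ideal (P i)) \<and> (\<forall>i<n. P i \<subset> P (Suc i))}"

definition char_mod :: "'a::comm_ring_1 set \<Rightarrow> nat" where
  "char_mod J = (if \<exists>n>0. (of_nat n :: 'a) \<in> J then LEAST n. n > 0 \<and> (of_nat n :: 'a) \<in> J else 0)"

definition equicharacteristic :: "'a::comm_ring_1 set \<Rightarrow> bool" where
  "equicharacteristic m \<longleftrightarrow> char_mod ({0} :: 'a set) = char_mod m"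

definition radical :: "'a::comm_ring_1 set \<Rightarrow> 'a set" where
  "radical I = {x. \<exists>n. x ^ n \<in> I}"

definition primary_ideal :: "'a::comm_ring_1 set \<Rightarrow> bool" where
  "primary_ideal I \<longleftrightarrow> is_ideal I \<and> I \<noteq> UNIV \<and> (\<forall>x y. x * y \<in> I \<longrightarrow> x \<in> I \<or> y \<in> radical I)"

definition m_primary :: "'a::comm_ring_1 set \<Rightarrow> 'a set \<Rightarrow> bool" where
  "m_primary m I \<longleftrightarrow> primary_ideal I \<and> radical I = m"

definition mu :: "'a::comm_ring_1 set \<Rightarrow> nat" where
  "mu I = (LEAST n. \<exists>S. finite S \<and> card S = n \<and> ideal_gen S = I)"

definition fin_gen_module :: "('a::comm_ring_1 \<Rightarrow> 'm::ab_group_add \<Rightarrow> 'm) \<Rightarrow> bool" where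
  "fin_gen_module sc \<longleftrightarrow> (\<exists>S. finite S \<and> module.span sc S = UNIV)"

definition ideal_times :: "('a::comm_ring_1 \<Rightarrow> 'm::ab_group_add \<Rightarrow> 'm) \<Rightarrow> 'a set \<Rightarrow> 'm set \<Rightarrow> 'm set" where
  "ideal_times sc I N = module.span sc {sc a v | a v. a \<in> I \<and> v \<in> N}"

fun ideal_pow_mod :: "('a::comm_ring_1 \<Rightarrow> 'm::ab_group_add \<Rightarrow> 'm) \<Rightarrow> 'a set \<Rightarrow> nat \<Rightarrow> 'm set" where
  "ideal_pow_mod sc I 0 = UNIV"
| "ideal_pow_mod sc I (Suc n) = ideal_times sc I (ideal_pow_mod sc I n)"

text \<open>length of the quotient module N / N' (N' \<subseteq> N submodules): supremum of lengths of
  strict chains of submodules from N' to N\<close>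
definition mod_length :: "('a::comm_ring_1 \<Rightarrow> 'm::ab_group_add \<Rightarrow> 'm) \<Rightarrow> 'm set \<Rightarrow> 'm set \<Rightarrow> enat" where
  "mod_length sc N N' = Sup {enat k | k. \<exists>C :: nat \<Rightarrow> 'm set. C 0 = N' \<and> C k = N \<and>
      (\<forall>i\<le>k. module.subspace sc (C i)) \<and> (\<forall>i<k. C i \<subset> C (Suc i))}"

definition regular_seq :: "('a::comm_ring_1 \<Rightarrow> 'm::ab_group_add \<Rightarrow> 'm) \<Rightarrow> 'a set \<Rightarrow> 'a list \<Rightarrow> bool" where
  "regular_seq sc m xs \<longleftrightarrow> set xs \<subseteq> m \<and>
     ideal_times sc (ideal_gen (set xs)) UNIV \<noteq> UNIV \<and>
     (\<forall>i<length xs. \<forall>v. sc (xs ! i) v \<in> ideal_times sc (ideal_gen (set (take i xs))) UNIV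
          \<longrightarrow> v \<in> ideal_times sc (ideal_gen (set (take i xs))) UNIV)"

definition depth :: "('a::comm_ring_1 \<Rightarrow> 'm::ab_group_add \<Rightarrow> 'm) \<Rightarrow> 'a set \<Rightarrow> enat" where
  "depth sc m = Sup {enat (length xs) | xs. regular_seq sc m xs}"

definition hilbert_fun :: "('a::comm_ring_1 \<Rightarrow> 'm::ab_group_add \<Rightarrow> 'm) \<Rightarrow> 'a set \<Rightarrow> nat \<Rightarrow> enat" where
  "hilbert_fun sc I n = mod_length sc (ideal_pow_mod sc I n) (ideal_pow_mod sc I (Suc n))"

end

theory Submission
  imports Defs "HOL-Library.Set_Algebras"
begin

text \<open>
  Prime avoidance gives generators \<open>x\<^sub>1, \<dots>, x\<^sub>d, z\<close> of \<open>I\<close> such that \<open>x\<^sub>1, \<dots>, x\<^sub>d\<close> is an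
  \<open>M\<close>-regular sequence. Let \<open>J = (x\<^sub>1, \<dots>, x\<^sub>d)\<close>. As \<open>d = dim A\<close>, the modules \<open>M/J\<^sup>kM\<close> have
  finite length. Multiplication by \<open>z\<close> is an endomorphism of the finite length module
  \<open>I\<^sup>kM/J\<^bsup>k+1\<^esup>M\<close>; its cokernel is \<open>I\<^sup>kM/I\<^bsup>k+1\<^esup>M\<close> because \<open>I\<^bsup>k+1\<^esup>M = zI\<^sup>kM + J\<^bsup>k+1\<^esup>M\<close>, hence the
  Hilbert function at \<open>k\<close> is the length of its kernel
  \<open>{v \<in> I\<^sup>kM. zv \<in> J\<^bsup>k+1\<^esup>M}/J\<^bsup>k+1\<^esup>M\<close>. Multiplication by \<open>x\<^sub>d\<close> maps this kernel into the one for
  \<open>k + 1\<close>, injectively since \<open>(J\<^bsup>k+2\<^esup>M : x\<^sub>d) = J\<^bsup>k+1\<^esup>M\<close> for a regular sequence.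

  All quotients \<open>M/N\<close> are represented by the submodule \<open>N\<close> of the fixed module \<open>M\<close>.
\<close>

section \<open>Submodules and lengths\<close>

text \<open>A fresh copy of the locale: constants defined in \<^locale>\<open>module\<close> itself would be shadowed by
  their instances for real vector spaces.\<close>

locale scalar_module = module scale
  for scale :: "'a::comm_ring_1 \<Rightarrow> 'b::ab_group_add \<Rightarrow> 'b"
begin

section \<open>Sums, images and preimages of submodules\<close>

declare set_plus_intro [rule del]

lemma mem_set_plus: "v \<in> A + B \<longleftrightarrow> (\<exists>a\<in>A. \<exists>b\<in>B. v = a + b)"
  for A B :: "'b set"
  by (auto elim!: set_plus_elim intro: set_plus_intro)

lemma subspace_set_plus:
  assumes "subspace A" "subspace B"
  shows "subspace (A + B)"
  unfolding subspace_def
proof (intro conjI ballI allI)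
  show "0 \<in> A + B" using subspace_0[OF assms(1)] subspace_0[OF assms(2)] by (force simp: mem_set_plus)
next
  fix u v assume "u \<in> A + B" "v \<in> A + B"
  then obtain a b a' b' where *: "a \<in> A" "b \<in> B" "u = a + b" "a' \<in> A" "b' \<in> B" "v = a' + b'"
    by (auto simp: mem_set_plus)
  then have "u + v = (a + a') + (b + b')" by simp
  moreover have "a + a' \<in> A" "b + b' \<in> B"
    using * subspace_add[OF assms(1)] subspace_add[OF assms(2)] by simp_all
  ultimately show "u + v \<in> A + B" by (metis set_plus_intro)
next
  fix c u assume "u \<in> A + B"
  then obtain a b where *: "a \<in> A" "b \<in> B" "u = a + b" by (auto simp: mem_set_plus)
  then have "scale c u = scale c a + scale c b" by (simp add: scale_right_distrib)
  moreover have "scale c a \<in> A" "scale c b \<in> B"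
    using * subspace_scale[OF assms(1)] subspace_scale[OF assms(2)] by simp_all
  ultimately show "scale c u \<in> A + B" by (metis set_plus_intro)
qed

lemma subspace_image_scale:
  assumes "subspace A"
  shows "subspace (scale x ` A)"
  unfolding subspace_def
proof (intro conjI ballI allI)
  show "0 \<in> scale x ` A" using subspace_0[OF assms] by (metis image_eqI scale_zero_right)
next
  fix u v assume "u \<in> scale x ` A" "v \<in> scale x ` A"
  then show "u + v \<in> scale x ` A"
    using subspace_add[OF assms] by (auto simp flip: scale_right_distrib)
next
  fix c u assume "u \<in> scale x ` A"
  then show "scale c u \<in> scale x ` A"
    using subspace_scale[OF assms] by (auto simp: scale_left_commute[of c] simp del: scale_scale)
qed

lemma subspace_vimage_scale:
  assumes "subspace A" "subspace B"
  shows "subspace {v \<in> A. scale x v \<in> B}"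
  using assms unfolding subspace_def
  by (auto simp: scale_right_distrib scale_left_commute[of x] simp del: scale_scale)

lemma subspace_range_scale_left: "subspace (range (\<lambda>a. scale a v))"
  by (rule subspaceI) (auto simp flip: scale_left_distrib intro: range_eqI[of _ _ 0])

lemma mem_range_scale_left: "v \<in> range (\<lambda>a. scale a v)"
  by (rule range_eqI[of _ _ 1]) simp

lemma set_plus_subspace_le:
  assumes "subspace C" "A \<subseteq> C" "B \<subseteq> C"
  shows "A + B \<subseteq> C"
  using assms(2,3) subspace_add[OF assms(1)] by (fastforce simp: mem_set_plus)

lemma subset_set_plus_left: "subspace B \<Longrightarrow> A \<subseteq> A + B"
  by (metis add.right_neutral set_plus_intro subsetI subspace_0)

lemma subset_set_plus_right: "subspace A \<Longrightarrow> B \<subseteq> A + B"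
  by (metis add.left_neutral set_plus_intro subsetI subspace_0)

lemma scale_image_set_plus: "scale x ` (A + B) = scale x ` A + scale x ` B"
proof (intro equalityI subsetI)
  fix v assume "v \<in> scale x ` (A + B)"
  then show "v \<in> scale x ` A + scale x ` B" by (force simp: mem_set_plus scale_right_distrib)
next
  fix v assume "v \<in> scale x ` A + scale x ` B"
  then obtain a b where "a \<in> A" "b \<in> B" "v = scale x a + scale x b" by (auto simp: mem_set_plus)
  then have "v = scale x (a + b)" "a + b \<in> A + B" by (simp_all add: scale_right_distrib set_plus_intro)
  then show "v \<in> scale x ` (A + B)" by (rule image_eqI)
qed

section \<open>Strict chains of submodules and the length of a quotient\<close>

inductive schain :: "nat \<Rightarrow> 'b set \<Rightarrow> 'b set \<Rightarrow> bool" where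
  schain_refl: "subspace N \<Longrightarrow> schain 0 N N"
| schain_step: "schain k N K \<Longrightarrow> subspace L \<Longrightarrow> K \<subset> L \<Longrightarrow> schain (Suc k) N L"

lemma schain_subspace:
  assumes "schain k N L"
  shows "subspace N" "subspace L" "N \<subseteq> L"
  using assms by (induction) auto

text \<open>Links \<open>schain\<close> to the indexed chains in \<open>mod_length\<close>. The
  inductive form is preferred because chains are concatenated, split and mapped by induction on
  their top step.\<close>

lemma schain_iff:
  "schain k N' N \<longleftrightarrow> (\<exists>C :: nat \<Rightarrow> 'b set. C 0 = N' \<and> C k = N \<and>
      (\<forall>i\<le>k. subspace (C i)) \<and> (\<forall>i<k. C i \<subset> C (Suc i)))"
proof (induction k arbitrary: N)
  case 0
  have "schain 0 N' N \<longleftrightarrow> N' = N \<and> subspace N" by (auto intro: schain_refl elim: schain.cases)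
  then show ?case by auto
next
  case (Suc k)
  show ?case
  proof
    assume "schain (Suc k) N' N"
    then obtain K where K: "schain k N' K" "subspace N" "K \<subset> N" by cases auto
    then obtain C where C: "C 0 = N'" "C k = K" "\<forall>i\<le>k. subspace (C i)" "\<forall>i<k. C i \<subset> C (Suc i)"
      using Suc.IH[THEN iffD1, OF K(1)] by auto
    show "\<exists>C. C 0 = N' \<and> C (Suc k) = N \<and> (\<forall>i\<le>Suc k. subspace (C i)) \<and>
        (\<forall>i<Suc k. C i \<subset> C (Suc i))"
      by (rule exI[of _ "C(Suc k := N)"]) (use C K in \<open>auto simp: le_Suc_eq less_Suc_eq\<close>)
  next
    assume "\<exists>C. C 0 = N' \<and> C (Suc k) = N \<and> (\<forall>i\<le>Suc k. subspace (C i)) \<and>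
        (\<forall>i<Suc k. C i \<subset> C (Suc i))"
    then obtain C where C: "C 0 = N'" "C (Suc k) = N" "\<forall>i\<le>Suc k. subspace (C i)"
        "\<forall>i<Suc k. C i \<subset> C (Suc i)" by blast
    then have "schain k N' (C k)" by (intro Suc.IH[THEN iffD2] exI[of _ C]) simp
    moreover have "subspace N" "C k \<subset> N" using C by auto
    ultimately show "schain (Suc k) N' N" by (rule schain_step)
  qed
qed

lemma mod_length_schain: "mod_length scale N N' = Sup {enat k | k. schain k N' N}"
  unfolding mod_length_def schain_iff ..

lemma schain_length_le: "schain k N' N \<Longrightarrow> enat k \<le> mod_length scale N N'"
  unfolding mod_length_schain by (auto intro!: Sup_upper)

lemma mod_length_leI: "(\<And>k. schain k N' N \<Longrightarrow> enat k \<le> c) \<Longrightarrow> mod_length scale N N' \<le> c"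
  unfolding mod_length_schain by (auto intro!: Sup_least)

lemma schain_exists:
  assumes "subspace N'" "subspace N" "N' \<subseteq> N"
  shows "\<exists>k. schain k N' N"
  using schain_refl[OF assms(1)] schain_step[of 0 N' N' N] assms by (cases "N' = N") auto

text \<open>A finite supremum in \<open>enat\<close> of a nonempty set is its maximum, so a finite
  length is realised by an actual chain.\<close>

lemma mod_length_attained:
  assumes "subspace N'" "subspace N" "N' \<subseteq> N" "mod_length scale N N' \<noteq> \<infinity>"
  obtains k where "schain k N' N" "mod_length scale N N' = enat k"
proof -
  let ?X = "{enat k | k. schain k N' N}"
  have ne: "?X \<noteq> {}" using schain_exists[OF assms(1-3)] by auto
  have "Sup ?X \<noteq> \<infinity>" using assms(4) by (simp add: mod_length_schain)
  then have "finite ?X" "Sup ?X = Max ?X" using ne unfolding Sup_enat_def by presburger+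
  then have "Sup ?X \<in> ?X" using Max_in[OF _ ne] by presburger
  then show ?thesis using that by (auto simp: mod_length_schain)
qed

lemma schain_trans:
  assumes "schain j K N" "schain i N' K"
  shows "schain (i + j) N' N"
  using assms by (induction) (auto intro: schain_step)

text \<open>Modular law: if an element \<open>v\<close> of \<open>L\<close> outside \<open>K\<close>
  were \<open>k + p\<close>, then \<open>p = v - k\<close> would lie in \<open>L\<close> and
  \<open>P\<close>, hence in \<open>K\<close>, and so would \<open>v\<close>.\<close>

lemma modular_strict:
  assumes "subspace K" "subspace L" "subspace P" "K \<subset> L" "K \<inter> P = L \<inter> P"
  shows "K + P \<subset> L + P"
proof -
  obtain v where v: "v \<in> L" "v \<notin> K" using assms by blast
  have "v \<notin> K + P"
  proof
    assume "v \<in> K + P"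
    then obtain k p where kp: "k \<in> K" "p \<in> P" "v = k + p" by (auto simp: mem_set_plus)
    then have "p = v - k" by simp
    then have "p \<in> L" using subspace_diff[OF assms(2), of v k] kp v assms(4) by blast
    then have "p \<in> K" using kp assms(5) by blast
    then show False using kp v subspace_add[OF assms(1)] by auto
  qed
  moreover have "v \<in> L + P" using subset_set_plus_left[OF assms(3), of L] v by blast
  moreover have "K + P \<subseteq> L + P" using assms(4) by (intro set_plus_mono2) auto
  ultimately show ?thesis by blast
qed

text \<open>Intersecting a chain with \<open>P\<close> and adding \<open>P\<close> to it gives two
  weakly increasing chains. By \<open>modular_strict\<close> each strict step survives in at least
  one of them. This takes the place of the Jordan-Hoelder theorem.\<close>

lemma schain_split:
  assumes "schain k N K" "subspace P" "N \<subseteq> P"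
  shows "\<exists>i j. schain i N (K \<inter> P) \<and> schain j P (K + P) \<and> k \<le> i + j"
  using assms
proof (induction)
  case (schain_refl N)
  have "N \<inter> P = N" "N + P = P"
    using schain_refl set_plus_subspace_le[of P N P] subset_set_plus_right[of N P] by auto
  then show ?case using schain.schain_refl schain_refl by (metis le0)
next
  case (schain_step k N K L)
  then obtain i j where ij: "schain i N (K \<inter> P)" "schain j P (K + P)" "k \<le> i + j" by auto
  have sK: "subspace K" using schain_step schain_subspace by blast
  have s: "subspace (L \<inter> P)" "subspace (L + P)"
    using schain_step subspace_inter subspace_set_plus by auto
  have le: "K \<inter> P \<subseteq> L \<inter> P" "K + P \<subseteq> L + P"
    using schain_step.hyps set_plus_mono2[of K L P P] by auto
  show ?case
  proof (cases "K \<inter> P = L \<inter> P")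
    case True
    have "schain (Suc j) P (L + P)"
      using modular_strict[OF sK _ _ _ True] schain_step ij s by (auto intro: schain.schain_step)
    then show ?thesis using ij True by (intro exI[of _ i] exI[of _ "Suc j"]) auto
  next
    case False
    then have 1: "schain (Suc i) N (L \<inter> P)" using ij s le by (auto intro: schain.schain_step)
    show ?thesis
    proof (cases "K + P = L + P")
      case True
      then show ?thesis using ij 1 by (intro exI[of _ "Suc i"] exI[of _ j]) auto
    next
      case False
      then have "schain (Suc j) P (L + P)" using ij s le by (auto intro: schain.schain_step)
      then show ?thesis using ij 1 by (intro exI[of _ "Suc i"] exI[of _ "Suc j"]) auto
    qed
  qed
qed

text \<open>This half of additivity also covers infinite lengths; it later serves to prove that a
  length is finite.\<close>

lemma mod_length_le_add:
  assumes "subspace P" "N' \<subseteq> P" "P \<subseteq> N"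
  shows "mod_length scale N N' \<le> mod_length scale N P + mod_length scale P N'"
proof (rule mod_length_leI)
  fix k assume k: "schain k N' N"
  obtain i j where ij: "schain i N' (N \<inter> P)" "schain j P (N + P)" "k \<le> i + j"
    using schain_split[OF k assms(1,2)] by blast
  have sN: "subspace N" using schain_subspace k by blast
  have "N \<inter> P = P" "N + P = N"
    using assms set_plus_subspace_le[of N N P] subset_set_plus_left[of P N] sN by auto
  then have "enat i \<le> mod_length scale P N'" "enat j \<le> mod_length scale N P"
    using ij schain_length_le by auto
  then have "enat j + enat i \<le> mod_length scale N P + mod_length scale P N'" by (rule add_mono[rotated])
  moreover have "enat k \<le> enat j + enat i" using ij(3) by simp
  ultimately show "enat k \<le> mod_length scale N P + mod_length scale P N'" by (rule order_trans[rotated])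
qed

lemma mod_length_mono:
  assumes "subspace N'" "subspace P'" "subspace P" "subspace N" "N' \<subseteq> P'" "P' \<subseteq> P" "P \<subseteq> N"
  shows "mod_length scale P P' \<le> mod_length scale N N'"
proof (rule mod_length_leI)
  fix k assume k: "schain k P' P"
  obtain i j where "schain i N' P'" "schain j P N" using schain_exists assms by meson
  then have "schain (i + k + j) N' N" using k schain_trans by blast
  then have "enat (i + k + j) \<le> mod_length scale N N'" by (rule schain_length_le)
  then show "enat k \<le> mod_length scale N N'" by (rule order_trans[rotated]) simp
qed

text \<open>For the other half, finiteness supplies chains that attain the two lengths, and these
  are concatenated.\<close>

lemma mod_length_add:
  assumes "subspace N'" "subspace P" "subspace N" "N' \<subseteq> P" "P \<subseteq> N" "mod_length scale N N' \<noteq> \<infinity>"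
  shows "mod_length scale N N' = mod_length scale N P + mod_length scale P N'"
proof (rule antisym)
  show "mod_length scale N N' \<le> mod_length scale N P + mod_length scale P N'"
    using assms by (intro mod_length_le_add)
  have le: "mod_length scale N P \<le> mod_length scale N N'" "mod_length scale P N' \<le> mod_length scale N N'"
    using assms(1-5) by (intro mod_length_mono; simp)+
  obtain j where j: "schain j P N" "mod_length scale N P = enat j"
    using mod_length_attained[OF assms(2,3,5)] le(1) assms(6) by (metis enat_ord_simps(5))
  obtain i where i: "schain i N' P" "mod_length scale P N' = enat i"
    using mod_length_attained[OF assms(1,2,4)] le(2) assms(6) by (metis enat_ord_simps(5))
  show "mod_length scale N P + mod_length scale P N' \<le> mod_length scale N N'"
    using schain_length_le[OF schain_trans[OF j(1) i(1)]] i(2) j(2) by (simp add: add.commute)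
qed

text \<open>Strict monotonicity is asked only between \<open>N'\<close> and \<open>N\<close>, since
  images and preimages under a multiplication are strict only on such an interval.\<close>

lemma schain_map:
  assumes "schain k N' N"
    and sub: "\<And>C. subspace C \<Longrightarrow> N' \<subseteq> C \<Longrightarrow> C \<subseteq> N \<Longrightarrow> subspace (f C)"
    and less: "\<And>C D. subspace C \<Longrightarrow> subspace D \<Longrightarrow> N' \<subseteq> C \<Longrightarrow> C \<subset> D \<Longrightarrow> D \<subseteq> N \<Longrightarrow> f C \<subset> f D"
  shows "schain k (f N') (f N)"
proof -
  have "schain k (f N') (f K)" if "schain k N' K" "K \<subseteq> N" for K
    using that
  proof (induction k arbitrary: K)
    case 0
    then have "K = N'" "subspace K" by (cases; simp)+
    then show ?case using sub[of K] 0 by (simp add: schain_refl)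
  next
    case (Suc k)
    from Suc.prems(1) obtain L where L: "schain k N' L" "subspace K" "L \<subset> K" by cases auto
    have s: "subspace L" "N' \<subseteq> L" using schain_subspace[OF L(1)] by blast+
    have "schain k (f N') (f L)" using Suc.IH[OF L(1)] L(3) Suc.prems(2) by blast
    moreover have "subspace (f K)" using sub[OF L(2)] s(2) L(3) Suc.prems(2) by blast
    moreover have "f L \<subset> f K" using less[OF s(1) L(2) s(2) L(3) Suc.prems(2)] .
    ultimately show ?case by (rule schain_step)
  qed
  then show ?thesis using assms(1) by blast
qed

lemma mod_length_le_map:
  assumes "\<And>C. subspace C \<Longrightarrow> N' \<subseteq> C \<Longrightarrow> C \<subseteq> N \<Longrightarrow> subspace (f C)"
    and "\<And>C D. subspace C \<Longrightarrow> subspace D \<Longrightarrow> N' \<subseteq> C \<Longrightarrow> C \<subset> D \<Longrightarrow> D \<subseteq> N \<Longrightarrow> f C \<subset> f D"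
  shows "mod_length scale N N' \<le> mod_length scale (f N) (f N')"
proof (rule mod_length_leI)
  fix k assume "schain k N' N"
  then have "schain k (f N') (f N)" by (rule schain_map) (fact assms)+
  then show "enat k \<le> mod_length scale (f N) (f N')" by (rule schain_length_le)
qed

text \<open>First isomorphism theorem for the map from N to M/P given by multiplication by x. Images
  and preimages carry strict chains to strict chains in both directions.\<close>

lemma mod_length_image_scale:
  assumes "subspace N" "subspace P"
  shows "mod_length scale (scale x ` N + P) P = mod_length scale N {v \<in> N. scale x v \<in> P}"
    (is "_ = mod_length scale N ?K")
proof (rule antisym)
  let ?f = "\<lambda>C. scale x ` C + P" and ?g = "\<lambda>C. {v \<in> N. scale x v \<in> C}"
  have sK: "subspace ?K" using subspace_vimage_scale assms by blast
  have fK: "?f ?K = P"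
    using set_plus_subspace_le[of P "scale x ` ?K" P] subset_set_plus_right[of "scale x ` ?K" P]
      subspace_image_scale[OF sK] assms by auto
  have "mod_length scale N ?K \<le> mod_length scale (?f N) (?f ?K)"
  proof (rule mod_length_le_map)
    fix C D assume *: "subspace C" "subspace D" "?K \<subseteq> C" "C \<subset> D" "D \<subseteq> N"
    then obtain d where d: "d \<in> D" "d \<notin> C" by blast
    have "scale x d \<notin> ?f C"
    proof
      assume "scale x d \<in> ?f C"
      then obtain c p where cp: "c \<in> C" "p \<in> P" "scale x d = scale x c + p"
        by (auto simp: mem_set_plus)
      then have "scale x (d - c) = p" by (simp add: scale_right_diff_distrib)
      moreover have "d - c \<in> N" using subspace_diff[OF assms(1)] * d cp by blast
      ultimately have "d - c \<in> C" using * cp by auto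
      then show False using subspace_add[OF *(1), of "d - c" c] cp d by auto
    qed
    moreover have "scale x d \<in> ?f D"
      using subset_set_plus_left[OF assms(2), of "scale x ` D"] d by blast
    moreover have "?f C \<subseteq> ?f D" using * by (intro set_plus_mono2) auto
    ultimately show "?f C \<subset> ?f D" by blast
  qed (use assms subspace_set_plus subspace_image_scale in blast)
  then show "mod_length scale N ?K \<le> mod_length scale (?f N) P" using fK by simp
  have gN: "?g (?f N) = N" using subset_set_plus_left[OF assms(2), of "scale x ` N"] by auto
  have "mod_length scale (?f N) P \<le> mod_length scale (?g (?f N)) (?g P)"
  proof (rule mod_length_le_map)
    fix C D assume *: "subspace C" "subspace D" "P \<subseteq> C" "C \<subset> D" "D \<subseteq> ?f N"
    then obtain d where d: "d \<in> D" "d \<notin> C" by blast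
    then obtain n p where np: "n \<in> N" "p \<in> P" "d = scale x n + p"
      using subsetD[OF *(5) d(1)] by (auto simp: mem_set_plus)
    have "scale x n \<in> D" using subspace_diff[OF *(2), of d p] np d * by auto
    moreover have "scale x n \<notin> C" using subspace_add[OF *(1), of "scale x n" p] np d * by auto
    ultimately show "?g C \<subset> ?g D" using np * by blast
  qed (use assms subspace_vimage_scale in blast)
  then show "mod_length scale (?f N) P \<le> mod_length scale N ?K" using gN by simp
qed

text \<open>The length of N/P is computed once through the image \<open>?Z\<close> and once through
  the kernel \<open>?K\<close>. As \<open>?Z\<close>/P and N/\<open>?K\<close> have equal length,
  this common term cancels; cancellation in \<open>enat\<close> needs it to be finite.\<close>

lemma mod_length_coker_eq_ker:
  assumes "subspace N" "subspace P" "P \<subseteq> N" "scale x ` N \<subseteq> N"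
    and "mod_length scale N P \<noteq> \<infinity>"
  shows "mod_length scale N (scale x ` N + P) = mod_length scale {v \<in> N. scale x v \<in> P} P"
proof -
  let ?K = "{v \<in> N. scale x v \<in> P}" and ?Z = "scale x ` N + P"
  have s: "subspace ?K" "subspace ?Z"
    using assms subspace_vimage_scale subspace_set_plus subspace_image_scale by auto
  have le: "P \<subseteq> ?Z" "?Z \<subseteq> N" "P \<subseteq> ?K" "?K \<subseteq> N"
    using assms subset_set_plus_right subspace_image_scale set_plus_subspace_le subspace_scale by auto
  have "mod_length scale N P = mod_length scale N ?Z + mod_length scale ?Z P"
    using assms s le by (intro mod_length_add) auto
  moreover have "mod_length scale N P = mod_length scale N ?K + mod_length scale ?K P"
    using assms s le by (intro mod_length_add) auto
  moreover have "mod_length scale ?Z P = mod_length scale N ?K"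
    using assms by (intro mod_length_image_scale)
  ultimately show ?thesis using assms(5)
    by (cases "mod_length scale N ?Z"; cases "mod_length scale N ?K"; cases "mod_length scale ?K P") auto
qed

text \<open>The last hypothesis says that multiplication by x induces an injection of N/P into M/P';
  its image lies in N'/P'.\<close>

lemma mod_length_ker_le:
  assumes "subspace N" "subspace P" "subspace N'" "subspace P'"
    and "P \<subseteq> N" "P' \<subseteq> N'" "scale x ` N \<subseteq> N'" "\<And>v. v \<in> N \<Longrightarrow> scale x v \<in> P' \<longleftrightarrow> v \<in> P"
  shows "mod_length scale N P \<le> mod_length scale N' P'"
proof -
  have "{v \<in> N. scale x v \<in> P'} = P" using assms by auto
  then have "mod_length scale N P = mod_length scale (scale x ` N + P') P'"
    using mod_length_image_scale[OF assms(1,4)] by simp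
  also have "\<dots> \<le> mod_length scale N' P'"
    using assms subspace_set_plus subspace_image_scale set_plus_subspace_le subset_set_plus_right
    by (intro mod_length_mono) auto
  finally show ?thesis .
qed

end

section \<open>Noetherian modules and associated primes\<close>

interpretation ring_self: scalar_module "(*) :: 'a::comm_ring_1 \<Rightarrow> 'a \<Rightarrow> 'a"
  by unfold_locales (simp_all add: algebra_simps)

section \<open>Ideals, prime ideals and prime avoidance\<close>

lemma is_ideal_iff_subspace: "is_ideal I \<longleftrightarrow> ring_self.subspace I"
  unfolding is_ideal_def ring_self.subspace_def ..

lemma is_ideal_ideal_gen: "is_ideal (ideal_gen S)"
  unfolding is_ideal_iff_subspace ideal_gen_def by simp

lemma ideal_gen_minimal: "S \<subseteq> I \<Longrightarrow> is_ideal I \<Longrightarrow> ideal_gen S \<subseteq> I"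
  unfolding is_ideal_iff_subspace ideal_gen_def by (rule ring_self.span_minimal)

lemma ideal_gen_superset: "S \<subseteq> ideal_gen S"
  unfolding ideal_gen_def by (rule ring_self.span_superset)

lemma is_ideal_0: "is_ideal I \<Longrightarrow> 0 \<in> I"
  and is_ideal_add: "is_ideal I \<Longrightarrow> x \<in> I \<Longrightarrow> y \<in> I \<Longrightarrow> x + y \<in> I"
  and is_ideal_mult: "is_ideal I \<Longrightarrow> x \<in> I \<Longrightarrow> a * x \<in> I"
  unfolding is_ideal_def by blast+

lemma is_ideal_mult_right: "is_ideal I \<Longrightarrow> x \<in> I \<Longrightarrow> x * a \<in> I"
  using is_ideal_mult[of I x a] by (simp add: mult.commute)

lemma is_ideal_diff: "is_ideal I \<Longrightarrow> x \<in> I \<Longrightarrow> y \<in> I \<Longrightarrow> x - y \<in> I"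
  unfolding is_ideal_iff_subspace by (rule ring_self.subspace_diff)

lemma is_ideal_add_cancel: "is_ideal I \<Longrightarrow> y \<in> I \<Longrightarrow> x + y \<in> I \<longleftrightarrow> x \<in> I"
  using is_ideal_diff[of I "x + y" y] is_ideal_add[of I x y] by auto

lemma is_prime_ideal_power: "is_prime_ideal P \<Longrightarrow> x ^ n \<in> P \<Longrightarrow> x \<in> P"
proof (induction n)
  case 0
  then have "a \<in> P" for a using is_ideal_mult[of P 1 a] by (auto simp: is_prime_ideal_def)
  then show ?case by blast
next
  case (Suc n)
  then show ?case by (auto simp: is_prime_ideal_def)
qed

lemma is_prime_ideal_one: "is_prime_ideal P \<Longrightarrow> 1 \<notin> P"
  using is_ideal_mult[of P 1] by (fastforce simp: is_prime_ideal_def)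

lemma is_prime_ideal_prod:
  assumes "is_prime_ideal P" "finite X" "\<And>x. x \<in> X \<Longrightarrow> f x \<notin> P"
  shows "prod f X \<notin> P"
  using assms(2,3)
proof (induction X)
  case empty
  then show ?case using is_prime_ideal_one[OF assms(1)] by simp
next
  case (insert x X)
  then show ?case using assms(1) by (auto simp: is_prime_ideal_def)
qed

text \<open>Prime avoidance for the coset a + B, by induction on the set of primes. A minimal prime
  \<open>Q\<close> is set aside and the others are avoided first; if the element found lies in
  \<open>Q\<close>, it is corrected by an element of B.\<close>

lemma coset_prime_avoidance:
  fixes a :: "'a::comm_ring_1"
  assumes "finite \<P>" "is_ideal B"
    and "\<And>P. P \<in> \<P> \<Longrightarrow> is_prime_ideal P" "\<And>P. P \<in> \<P> \<Longrightarrow> \<not> insert a B \<subseteq> P"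
  shows "\<exists>b\<in>B. \<forall>P\<in>\<P>. a + b \<notin> P"
  using assms(1,3,4)
proof (induction rule: finite_psubset_induct)
  case (psubset \<P>)
  show ?case
  proof (cases "\<P> = {}")
    case True
    then show ?thesis using is_ideal_0[OF assms(2)] by auto
  next
    case False
    then obtain Q where Q: "Q \<in> \<P>" "\<forall>P\<in>\<P>. P \<subseteq> Q \<longrightarrow> Q = P"
      using finite_has_minimal[OF psubset.hyps] by blast
    have pQ: "is_prime_ideal Q" and iQ: "is_ideal Q"
      using psubset.prems(1)[OF Q(1)] by (auto simp: is_prime_ideal_def)
    let ?R = "\<P> - {Q}"
    obtain b where b: "b \<in> B" "\<forall>P\<in>?R. a + b \<notin> P"
      using psubset.IH[of ?R] psubset.prems Q(1) by blast
    show ?thesis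
    proof (cases "a + b \<in> Q")
      case False
      then show ?thesis using b by blast
    next
      case True
      have "\<not> B \<subseteq> Q"
      proof
        assume "B \<subseteq> Q"
        moreover from this have "a \<in> Q" using True b(1) is_ideal_add_cancel[OF iQ, of b a] by blast
        ultimately show False using psubset.prems(2)[OF Q(1)] by blast
      qed
      then obtain c where c: "c \<in> B" "c \<notin> Q" by blast
      have "\<exists>q. q \<in> P \<and> q \<notin> Q" if "P \<in> ?R" for P using Q that by blast
      then obtain q where q: "\<And>P. P \<in> ?R \<Longrightarrow> q P \<in> P" "\<And>P. P \<in> ?R \<Longrightarrow> q P \<notin> Q" by metis
      \<comment> \<open>\<open>?e\<close> lies in B and in every prime of \<open>?R\<close>, but not
        in \<open>Q\<close>. Adding it moves \<open>a + b\<close> out of \<open>Q\<close> and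
        changes nothing modulo the other primes.\<close>
      let ?e = "c * prod q ?R"
      have "prod q ?R \<notin> Q" by (rule is_prime_ideal_prod[OF pQ]) (use psubset.hyps q(2) in auto)
      then have eQ: "?e \<notin> Q" using c pQ by (auto simp: is_prime_ideal_def)
      have "a + (b + ?e) \<notin> P" if P: "P \<in> \<P>" for P
      proof (cases "P = Q")
        case True
        then show ?thesis using eQ is_ideal_add_cancel[OF iQ \<open>a + b \<in> Q\<close>, of ?e]
          by (simp add: add_ac)
      next
        case False
        then have R: "P \<in> ?R" using P by blast
        have iP: "is_ideal P" using psubset.prems(1)[OF P] by (simp add: is_prime_ideal_def)
        have "q P dvd prod q ?R" using R psubset.hyps by (intro dvd_prodI) auto
        then have "prod q ?R \<in> P" using q(1)[OF R] is_ideal_mult_right[OF iP] by (auto elim!: dvdE)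
        then have "?e \<in> P" using is_ideal_mult[OF iP] by blast
        then show ?thesis using b(2) R is_ideal_add_cancel[OF iP, of ?e "a + b"] by (simp add: add_ac)
      qed
      moreover have "b + ?e \<in> B"
        using b c is_ideal_add[OF assms(2)] is_ideal_mult_right[OF assms(2)] by blast
      ultimately show ?thesis by blast
    qed
  qed
qed

section \<open>Noetherian modules and the existence of prime ideals\<close>

locale noetherian_module = scalar_module +
  assumes fin_gen_submodule: "subspace N \<Longrightarrow> \<exists>S. finite S \<and> span S = N"
begin

text \<open>Zorn's lemma applies because a finite generating set of the union of a chain already
  lies in one member, which is then the whole union.\<close>

lemma maximal_submodule_exists:
  assumes "F \<noteq> {}" "\<And>N. N \<in> F \<Longrightarrow> subspace N"
  shows "\<exists>N\<in>F. \<forall>K\<in>F. N \<subseteq> K \<longrightarrow> K = N"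
proof (rule subset_Zorn_nonempty[OF assms(1)])
  fix C assume C: "C \<noteq> {}" "subset.chain F C"
  have sub: "subspace N" if "N \<in> C" for N using that C(2) assms(2) by (auto simp: subset.chain_def)
  have "subspace (\<Union>C)"
  proof (rule subspaceI)
    show "0 \<in> \<Union>C" using C(1) sub subspace_0 by blast
  next
    fix x y assume "x \<in> \<Union>C" "y \<in> \<Union>C"
    then obtain N where "N \<in> C" "{x, y} \<subseteq> N"
      using finite_subset_Union_chain[of "{x, y}" C F] C by auto
    then show "x + y \<in> \<Union>C" using sub subspace_add[of N x y] by blast
  next
    fix c x assume "x \<in> \<Union>C"
    then show "scale c x \<in> \<Union>C" using sub subspace_scale by blast
  qed
  then obtain S where S: "finite S" "span S = \<Union>C" using fin_gen_submodule by blast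
  have "S \<subseteq> \<Union>C" using S(2) span_superset by blast
  then obtain N where N: "N \<in> C" "S \<subseteq> N"
    using finite_subset_Union_chain[OF S(1) _ C(1,2)] by blast
  then have "\<Union>C = N" using S(2) span_minimal[OF N(2) sub[OF N(1)]] by blast
  then show "\<Union>C \<in> F" using N(1) C(2) by (auto simp: subset.chain_def)
qed

lemma noetherian_induct:
  assumes "subspace N" "\<And>N. subspace N \<Longrightarrow> (\<And>K. subspace K \<Longrightarrow> N \<subset> K \<Longrightarrow> P K) \<Longrightarrow> P N"
  shows "P N"
proof (rule ccontr)
  assume "\<not> P N"
  let ?F = "{N. subspace N \<and> \<not> P N}"
  have "?F \<noteq> {}" using assms(1) \<open>\<not> P N\<close> by blast
  then obtain L where L: "L \<in> ?F" "\<forall>K\<in>?F. L \<subseteq> K \<longrightarrow> K = L"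
    using maximal_submodule_exists[of ?F] by blast
  then have "P L" using assms(2)[of L] by blast
  then show False using L(1) by blast
qed

end

lemma noetherian_ring_self:
  assumes "noetherian_ring TYPE('a::comm_ring_1)"
  shows "noetherian_module ((*) :: 'a \<Rightarrow> 'a \<Rightarrow> 'a)"
  using assms by unfold_locales
    (metis ideal_gen_def is_ideal_iff_subspace noetherian_ring_def)

lemma maximal_ideal_exists:
  fixes F :: "'a::comm_ring_1 set set"
  assumes "noetherian_ring TYPE('a)" "F \<noteq> {}" "\<And>J. J \<in> F \<Longrightarrow> is_ideal J"
  shows "\<exists>J\<in>F. \<forall>K\<in>F. J \<subseteq> K \<longrightarrow> K = J"
  using noetherian_module.maximal_submodule_exists[OF noetherian_ring_self[OF assms(1)] assms(2)]
    assms(3) unfolding is_ideal_iff_subspace by blast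

text \<open>An ideal maximal among those containing I and disjoint from the multiplicative set S is
  prime. This does the work of localisation.\<close>

lemma prime_ideal_disjoint_exists:
  fixes I S :: "'a::comm_ring_1 set"
  assumes "noetherian_ring TYPE('a)" "is_ideal I" "I \<inter> S = {}"
    and "1 \<in> S" "\<And>x y. x \<in> S \<Longrightarrow> y \<in> S \<Longrightarrow> x * y \<in> S"
  shows "\<exists>P. is_prime_ideal P \<and> I \<subseteq> P \<and> P \<inter> S = {}"
proof -
  let ?F = "{J. is_ideal J \<and> I \<subseteq> J \<and> J \<inter> S = {}}"
  have "I \<in> ?F" using assms(2,3) by simp
  then have "\<exists>J\<in>?F. \<forall>K\<in>?F. J \<subseteq> K \<longrightarrow> K = J"
    by (intro maximal_ideal_exists[OF assms(1)]) auto
  then obtain P where P: "is_ideal P" "I \<subseteq> P" "P \<inter> S = {}"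
    and max: "\<And>K. is_ideal K \<Longrightarrow> I \<subseteq> K \<Longrightarrow> K \<inter> S = {} \<Longrightarrow> P \<subseteq> K \<Longrightarrow> K = P"
    by (auto simp only: mem_Collect_eq Bex_def Ball_def)
  \<comment> \<open>Enlarging \<open>P\<close> by an element outside it must, by maximality, produce
    an element of S.\<close>
  have meets: "\<exists>p\<in>P. \<exists>r. p + x * r \<in> S" if "x \<notin> P" for x
  proof -
    let ?K = "P + (*) x ` UNIV"
    have K: "ring_self.subspace ?K"
      using P(1) unfolding is_ideal_iff_subspace
      by (intro ring_self.subspace_set_plus ring_self.subspace_image_scale) simp_all
    have "P \<subseteq> ?K"
      by (intro ring_self.subset_set_plus_left ring_self.subspace_image_scale) simp
    moreover have "x \<in> ?K"
      using set_plus_intro[OF is_ideal_0[OF P(1)], of "x * 1" "(*) x ` UNIV"] by (simp add: range_eqI[of _ _ 1])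
    ultimately have "?K \<inter> S \<noteq> {}"
      using P(2) max[of ?K] K that unfolding is_ideal_iff_subspace by blast
    then show ?thesis by (auto simp: ring_self.mem_set_plus)
  qed
  have "x \<in> P \<or> y \<in> P" if xy: "x * y \<in> P" for x y
  proof (rule ccontr)
    assume "\<not> (x \<in> P \<or> y \<in> P)"
    then obtain p r q s where *: "p \<in> P" "q \<in> P" "p + x * r \<in> S" "q + y * s \<in> S"
      using meets[of x] meets[of y] by auto
    \<comment> \<open>Every term of the expanded product has \<open>p\<close>, \<open>q\<close> or
      \<open>x * y\<close> as a factor, so the product lies in \<open>P\<close> as well as in
      S.\<close>
    have "(p + x * r) * (q + y * s) = (q + y * s) * p + ((x * r) * q + (r * s) * (x * y))"
      by (simp only: distrib_left distrib_right mult.assoc mult.commute mult.left_commute add_ac)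
    also have "\<dots> \<in> P" by (intro is_ideal_add[OF P(1)] is_ideal_mult[OF P(1)] * xy)
    finally show False using assms(5)[OF *(3,4)] P(3) by blast
  qed
  moreover have "P \<noteq> UNIV" using P(3) assms(4) by blast
  ultimately show ?thesis using P unfolding is_prime_ideal_def by blast
qed

context scalar_module
begin

text \<open>Induction on the generators: the coefficients of \<open>s\<close> that occur in N form a
  finitely generated ideal. Lifts of its generators to N, together with generators of the
  intersection of N with \<open>span S\<close>, generate N.\<close>

lemma fin_gen_submodule_of_noetherian_ring:
  assumes "noetherian_ring TYPE('a)" "finite S" "subspace N" "N \<subseteq> span S"
  shows "\<exists>T. finite T \<and> span T = N"
  using assms(2-4)
proof (induction S arbitrary: N)
  case empty
  then have "span {} = N" using subspace_0[of N] by auto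
  then show ?case by blast
next
  case (insert s S)
  let ?I = "{a. \<exists>n\<in>N. n - scale a s \<in> span S}"
  have idl: "is_ideal ?I"
    unfolding is_ideal_def
  proof (intro conjI ballI allI)
    show "0 \<in> ?I" using subspace_0[OF insert.prems(1)] span_zero by force
  next
    fix x y assume "x \<in> ?I" "y \<in> ?I"
    then obtain n n' where n: "n \<in> N" "n - scale x s \<in> span S" "n' \<in> N" "n' - scale y s \<in> span S" by blast
    have "(n + n') - scale (x + y) s = (n - scale x s) + (n' - scale y s)"
      by (simp add: algebra_simps)
    also have "\<dots> \<in> span S" using n span_add by blast
    finally show "x + y \<in> ?I" using n subspace_add[OF insert.prems(1)] by blast
  next
    fix a x assume "x \<in> ?I"
    then obtain n where n: "n \<in> N" "n - scale x s \<in> span S" by blast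
    have "scale a n - scale (a * x) s = scale a (n - scale x s)"
      by (simp add: algebra_simps)
    also have "\<dots> \<in> span S" using n span_scale by blast
    finally show "a * x \<in> ?I" using n subspace_scale[OF insert.prems(1)] by blast
  qed
  then obtain A where A: "finite A" "?I = ideal_gen A"
    using assms(1) unfolding noetherian_ring_def by blast
  have "\<forall>a\<in>A. \<exists>n. n \<in> N \<and> n - scale a s \<in> span S" using ideal_gen_superset[of A] A(2) by blast
  then obtain g where g: "\<And>a. a \<in> A \<Longrightarrow> g a \<in> N" "\<And>a. a \<in> A \<Longrightarrow> g a - scale a s \<in> span S" by metis
  obtain T where T: "finite T" "span T = N \<inter> span S"
    using insert.IH[of "N \<inter> span S"] insert.prems(1) subspace_inter by blast
  let ?U = "g ` A \<union> T"
  \<comment> \<open>The coefficients of \<open>s\<close> attained by \<open>span ?U\<close> form an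
    ideal containing the generators \<open>A\<close>, hence they exhaust \<open>?I\<close>.\<close>
  have gen: "\<exists>u\<in>span ?U. u - scale c s \<in> span S" if "c \<in> ?I" for c
  proof -
    let ?K = "{c. \<exists>u\<in>span ?U. u - scale c s \<in> span S}"
    have "is_ideal ?K"
      unfolding is_ideal_def
    proof (intro conjI ballI allI)
      show "0 \<in> ?K" using span_zero by force
    next
      fix x y assume "x \<in> ?K" "y \<in> ?K"
      then obtain n n' where n: "n \<in> span ?U" "n - scale x s \<in> span S"
          "n' \<in> span ?U" "n' - scale y s \<in> span S" by blast
      have "(n + n') - scale (x + y) s = (n - scale x s) + (n' - scale y s)"
        by (simp add: algebra_simps)
      also have "\<dots> \<in> span S" using n span_add by blast
      finally show "x + y \<in> ?K" using n span_add by blast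
    next
      fix a x assume "x \<in> ?K"
      then obtain n where n: "n \<in> span ?U" "n - scale x s \<in> span S" by blast
      have "scale a n - scale (a * x) s = scale a (n - scale x s)"
        by (simp add: algebra_simps)
      also have "\<dots> \<in> span S" using n span_scale by blast
      finally show "a * x \<in> ?K" using n span_scale by blast
    qed
    moreover have "A \<subseteq> ?K" using g(2) span_base[of _ ?U] by blast
    ultimately have "ideal_gen A \<subseteq> ?K" by (intro ideal_gen_minimal)
    then show ?thesis using that A(2) by blast
  qed
  have UN: "span ?U \<subseteq> N"
    using g(1) T(2) span_superset[of T] insert.prems(1) by (intro span_minimal) blast+
  moreover have "N \<subseteq> span ?U"
  proof
    fix n assume n: "n \<in> N"
    then obtain c where c: "n - scale c s \<in> span S" using insert.prems(2) span_breakdown_eq by blast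
    then obtain u where u: "u \<in> span ?U" "u - scale c s \<in> span S" using gen n by blast
    have "n - u = (n - scale c s) - (u - scale c s)" by simp
    then have "n - u \<in> span S" using c u(2) span_diff by metis
    moreover have "n - u \<in> N" using n u(1) UN subspace_diff[OF insert.prems(1)] by blast
    ultimately have "n - u \<in> span ?U" using T(2) span_mono[of T ?U] by blast
    then have "(n - u) + u \<in> span ?U" using u(1) by (rule span_add)
    then show "n \<in> span ?U" by simp
  qed
  ultimately show ?case using A(1) T(1) by (metis finite_UnI finite_imageI subset_antisym)
qed

lemma noetherian_moduleI:
  assumes "noetherian_ring TYPE('a)" "fin_gen_module scale"
  shows "noetherian_module scale"
proof unfold_locales
  obtain S where "finite S" "span S = UNIV" using assms(2) unfolding fin_gen_module_def by blast
  then show "\<exists>S. finite S \<and> span S = N" if "subspace N" for N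
    using fin_gen_submodule_of_noetherian_ring[OF assms(1), of S N] that by blast
qed

section \<open>Annihilators of elements and associated primes of M/N\<close>

definition colon :: "'b set \<Rightarrow> 'b \<Rightarrow> 'a set" where
  "colon N v = {a. scale a v \<in> N}"

definition nzd :: "'a \<Rightarrow> 'b set \<Rightarrow> bool" where
  "nzd x N \<longleftrightarrow> (\<forall>v. scale x v \<in> N \<longrightarrow> v \<in> N)"

text \<open>The associated primes of M/N: \<open>colon N v\<close> is the annihilator of the class
  of v, and \<open>nzd x N\<close> says that x is a nonzerodivisor on M/N.\<close>

definition ass :: "'b set \<Rightarrow> 'a set set" where
  "ass N = {P. is_prime_ideal P \<and> (\<exists>v. P = colon N v)}"

lemma is_ideal_colon: "subspace N \<Longrightarrow> is_ideal (colon N v)"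
  unfolding is_ideal_def colon_def subspace_def
  by (auto simp: scale_left_distrib simp flip: scale_scale)

lemma colon_scale: "subspace N \<Longrightarrow> colon N v \<subseteq> colon N (scale c v)"
  unfolding colon_def using subspace_scale by (fastforce simp only: scale_left_commute)

text \<open>A maximal annihilator among the multiples of v outside N is prime. Restricting to
  multiples of v ensures that the prime contains \<open>colon N v\<close>.\<close>

lemma ass_above_colon:
  assumes "noetherian_ring TYPE('a)" "subspace N" "v \<notin> N"
  shows "\<exists>c. scale c v \<notin> N \<and> colon N (scale c v) \<in> ass N"
proof -
  let ?F = "{colon N (scale c v) | c. scale c v \<notin> N}"
  have "colon N (scale 1 v) \<in> ?F" using assms(3) scale_one by (intro CollectI exI[of _ 1]) simp
  then have "\<exists>J\<in>?F. \<forall>K\<in>?F. J \<subseteq> K \<longrightarrow> K = J"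
    using is_ideal_colon[OF assms(2)] by (intro maximal_ideal_exists[OF assms(1)]) auto
  then obtain P where P: "P \<in> ?F" "\<forall>K\<in>?F. P \<subseteq> K \<longrightarrow> K = P" by (rule bexE)
  then obtain c where c: "P = colon N (scale c v)" "scale c v \<notin> N" by blast
  have "x \<in> P \<or> y \<in> P" if xy: "x * y \<in> P" for x y
  proof (cases "y \<in> P")
    case False
    then have "scale (y * c) v \<notin> N" by (simp add: c(1) colon_def)
    then have "colon N (scale (y * c) v) \<in> ?F" by blast
    moreover have "P \<subseteq> colon N (scale (y * c) v)"
      using colon_scale[OF assms(2), of "scale c v" y] c(1) by simp
    ultimately have "colon N (scale (y * c) v) = P" using P(2) by blast
    moreover have "scale (x * y) (scale c v) \<in> N" using xy unfolding c(1) colon_def by blast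
    then have "x \<in> colon N (scale (y * c) v)" unfolding colon_def by (simp only: mem_Collect_eq scale_scale mult.assoc)
    ultimately show ?thesis by blast
  qed simp
  moreover have "1 \<notin> P" using c by (simp add: colon_def)
  ultimately have "is_prime_ideal P"
    using is_ideal_colon[OF assms(2)] c(1) unfolding is_prime_ideal_def by blast
  then show ?thesis using c unfolding ass_def by blast
qed

lemma not_nzd_imp_ass:
  assumes "noetherian_ring TYPE('a)" "subspace N" "\<not> nzd x N"
  shows "\<exists>P\<in>ass N. x \<in> P"
proof -
  obtain v where v: "scale x v \<in> N" "v \<notin> N" using assms(3) unfolding nzd_def by blast
  then obtain c where c: "colon N (scale c v) \<in> ass N" using ass_above_colon[OF assms(1,2)] by blast
  have "x \<in> colon N (scale c v)" using colon_scale[OF assms(2)] v(1) by (auto simp: colon_def)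
  then show ?thesis using c by blast
qed

lemma nzd_notin_ass:
  assumes "nzd x N" "P \<in> ass N"
  shows "x \<notin> P"
proof
  assume "x \<in> P"
  then obtain v where v: "P = colon N v" "is_prime_ideal P" using assms(2) unfolding ass_def by blast
  then have "v \<in> N" using \<open>x \<in> P\<close> assms(1) by (simp add: colon_def nzd_def)
  then have "1 \<in> P" using v by (simp add: colon_def)
  then show False using is_prime_ideal_one v(2) by blast
qed

end

text \<open>Noetherian induction. If \<open>?P\<close> is the annihilator of v modulo N and is
  prime, then \<open>?L\<close>/N is a copy of A/\<open>?P\<close>, so passing from N to
  \<open>?L\<close> loses at most the associated prime \<open>?P\<close>.\<close>

lemma (in noetherian_module) finite_ass:
  assumes "noetherian_ring TYPE('a)" "subspace N"
  shows "finite (ass N)"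
  using assms(2)
proof (rule noetherian_induct)
  fix N assume 1: "subspace N" "\<And>K. subspace K \<Longrightarrow> N \<subset> K \<Longrightarrow> finite (ass K)"
  show "finite (ass N)"
  proof (cases "N = UNIV")
    case True
    then have "ass N = {}" by (auto simp: ass_def colon_def is_prime_ideal_def)
    then show ?thesis by simp
  next
    case False
    then obtain v where v: "v \<notin> N" "colon N v \<in> ass N" using ass_above_colon[OF assms(1) 1(1)] by blast
    let ?P = "colon N v" and ?L = "N + range (\<lambda>a. scale a v)"
    have L: "subspace ?L" using subspace_set_plus[OF 1(1) subspace_range_scale_left] .
    have "N \<subset> ?L"
      using subset_set_plus_left[OF subspace_range_scale_left, of N v]
        subset_set_plus_right[OF 1(1), of "range (\<lambda>a. scale a v)"] mem_range_scale_left[of v] v(1)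
      by blast
    then have fin: "finite (ass ?L)" using 1(2) L by blast
    have "ass N \<subseteq> insert ?P (ass ?L)"
    proof
      fix Q assume "Q \<in> ass N"
      then obtain w where w: "Q = colon N w" "is_prime_ideal Q" unfolding ass_def by blast
      show "Q \<in> insert ?P (ass ?L)"
      proof (cases "colon ?L w \<subseteq> Q")
        case True
        moreover have "Q \<subseteq> colon ?L w" using w(1) \<open>N \<subset> ?L\<close> by (auto simp: colon_def)
        ultimately show ?thesis using w(2) unfolding ass_def by blast
      next
        case False
        then obtain c where c: "scale c w \<in> ?L" "c \<notin> Q" by (auto simp: colon_def)
        then obtain n a where na: "n \<in> N" "scale c w = n + scale a v" by (auto simp: mem_set_plus)
        have pP: "is_prime_ideal ?P" using v(2) by (simp add: ass_def)
        have in_iff: "n' + u \<in> N \<longleftrightarrow> u \<in> N" if "n' \<in> N" for n' u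
          using that subspace_diff[OF 1(1), of "n' + u" n'] subspace_add[OF 1(1), of n' u] by auto
        have aP: "a \<notin> ?P" using c(2) w(1) na in_iff[OF na(1)] by (simp add: colon_def)
        \<comment> \<open>Modulo N, \<open>scale c w\<close> and \<open>scale a v\<close> agree. As
          c is outside the prime \<open>Q\<close> and a outside the prime \<open>?P\<close>, their
          annihilators are still \<open>Q\<close> and \<open>?P\<close>.\<close>
        have "x \<in> Q \<longleftrightarrow> x \<in> ?P" for x
        proof -
          have "x \<in> Q \<longleftrightarrow> x * c \<in> Q" using w(2) c(2) is_ideal_mult_right[of Q x c]
            by (auto simp: is_prime_ideal_def)
          also have "\<dots> \<longleftrightarrow> scale x (n + scale a v) \<in> N"
            using na(2) by (simp add: w(1) colon_def flip: scale_scale)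
          also have "\<dots> \<longleftrightarrow> x * a \<in> ?P"
            using in_iff[OF subspace_scale[OF 1(1) na(1), of x]] by (simp add: scale_right_distrib colon_def)
          also have "\<dots> \<longleftrightarrow> x \<in> ?P" using pP aP is_ideal_mult_right[of ?P x a]
            by (auto simp: is_prime_ideal_def)
          finally show ?thesis .
        qed
        then show ?thesis by blast
      qed
    qed
    then show ?thesis using fin finite_subset by blast
  qed
qed

section \<open>Regular sequences\<close>

context scalar_module
begin

text \<open>For J generated by \<open>xs\<close>, \<open>list_times xs K\<close> is JK and
  \<open>list_pow xs k\<close> is J^k M. Summing over the list lets a single generator be split
  off.\<close>

fun list_times :: "'a list \<Rightarrow> 'b set \<Rightarrow> 'b set" where
  "list_times [] K = {0}"
| "list_times (x # xs) K = scale x ` K + list_times xs K"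

fun list_pow :: "'a list \<Rightarrow> nat \<Rightarrow> 'b set" where
  "list_pow xs 0 = UNIV"
| "list_pow xs (Suc k) = list_times xs (list_pow xs k)"

text \<open>Weak regularity on M/N: the quotient of M/N by the sequence may vanish. Adding
  \<open>range (scale x)\<close> to N divides M/N by x.\<close>

fun regular_on :: "'b set \<Rightarrow> 'a list \<Rightarrow> bool" where
  "regular_on N [] \<longleftrightarrow> True"
| "regular_on N (x # xs) \<longleftrightarrow> nzd x N \<and> regular_on (N + range (scale x)) xs"

lemma set_plus_zero: "A + {0} = A" for A :: "'b set"
  by (auto simp: mem_set_plus)

lemma subspace_list_times: "subspace K \<Longrightarrow> subspace (list_times xs K)"
  by (induction xs) (auto intro: subspace_set_plus subspace_image_scale)

lemma subspace_list_pow: "subspace (list_pow xs k)"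
  by (induction k) (auto intro: subspace_list_times)

lemma subspace_range_scale: "subspace (range (scale x))"
  by (rule subspace_image_scale) simp

lemma list_times_append: "list_times (xs @ ys) K = list_times xs K + list_times ys K"
  by (induction xs) (simp_all add: add.assoc set_plus_zero add.commute[of "{0}"])

lemma list_times_snoc: "list_times (xs @ [x]) K = list_times xs K + scale x ` K"
  by (simp add: list_times_append set_plus_zero)

lemma list_times_set_plus: "list_times xs (K + L) = list_times xs K + list_times xs L"
  by (induction xs) (simp_all add: scale_image_set_plus add_ac set_plus_zero)

lemma list_times_image: "list_times xs (scale x ` K) = scale x ` list_times xs K"
proof (induction xs)
  case (Cons y xs)
  have "scale y ` scale x ` K = scale x ` scale y ` K"
    by (simp add: image_image scale_left_commute mult.commute)
  then show ?case by (simp add: Cons scale_image_set_plus)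
qed simp

lemma list_times_mono: "K \<subseteq> L \<Longrightarrow> list_times xs K \<subseteq> list_times xs L"
  by (induction xs) (simp_all add: image_mono set_plus_mono2)

lemma list_times_subset: "subspace K \<Longrightarrow> list_times xs K \<subseteq> K"
proof (induction xs)
  case (Cons x xs)
  moreover have "scale x ` K \<subseteq> K" using Cons.prems subspace_scale by blast
  ultimately show ?case by (simp add: set_plus_subspace_le)
qed (simp add: subspace_0)

lemma list_times_subset_snoc: "subspace K \<Longrightarrow> list_times xs K \<subseteq> list_times (xs @ [x]) K"
  by (simp add: list_times_snoc subset_set_plus_left subspace_image_scale)

lemma list_pow_Suc_subset: "list_pow xs (Suc k) \<subseteq> list_pow xs k"
  by (simp add: list_times_subset subspace_list_pow)

lemma list_pow_subset_snoc: "list_pow xs k \<subseteq> list_pow (xs @ [x]) k"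
proof (induction k)
  case (Suc k)
  have "list_times xs (list_pow xs k) \<subseteq> list_times xs (list_pow (xs @ [x]) k)"
    using Suc by (rule list_times_mono)
  also have "\<dots> \<subseteq> list_times (xs @ [x]) (list_pow (xs @ [x]) k)"
    by (rule list_times_subset_snoc) (rule subspace_list_pow)
  finally show ?case by simp
qed simp

lemma list_pow_scale_subset: "scale x ` list_pow (xs @ [x]) k \<subseteq> list_pow (xs @ [x]) (Suc k)"
  by (simp add: list_times_snoc subset_set_plus_right subspace_list_times subspace_list_pow)

text \<open>Monomials of degree k + 1 are sorted by whether x occurs in them. The formula serves
  both for the last regular element and for the extra generator of I.\<close>

lemma list_pow_snoc:
  "list_pow (xs @ [x]) (Suc k) = list_pow xs (Suc k) + scale x ` list_pow (xs @ [x]) k"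
proof (induction k)
  case 0
  then show ?case by (simp add: list_times_snoc)
next
  case (Suc k)
  let ?L = "list_pow (xs @ [x])"
  have "?L (Suc (Suc k)) = list_times xs (?L (Suc k)) + scale x ` ?L (Suc k)"
    by (simp only: list_pow.simps(2)[of _ "Suc k"] list_times_snoc)
  also have "list_times xs (?L (Suc k)) = list_pow xs (Suc (Suc k)) + scale x ` list_times xs (?L k)"
    by (subst Suc) (simp add: list_times_set_plus list_times_image)
  also have "\<dots> + scale x ` ?L (Suc k) =
      list_pow xs (Suc (Suc k)) + scale x ` (list_times xs (?L k) + ?L (Suc k))"
    by (simp add: scale_image_set_plus add.assoc)
  \<comment> \<open>The first summand is absorbed, since \<open>xs\<close> is part of
    \<open>xs @ [x]\<close>.\<close>
  also have "list_times xs (?L k) + ?L (Suc k) = ?L (Suc k)"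
  proof
    show "list_times xs (?L k) + ?L (Suc k) \<subseteq> ?L (Suc k)"
      using list_times_subset_snoc[OF subspace_list_pow, of xs "xs @ [x]" k x]
      by (intro set_plus_subspace_le subspace_list_pow) auto
    show "?L (Suc k) \<subseteq> list_times xs (?L k) + ?L (Suc k)"
      by (intro subset_set_plus_right subspace_list_times subspace_list_pow)
  qed
  finally show ?case .
qed

lemma ideal_times_ideal_gen:
  assumes "subspace K"
  shows "ideal_times scale (ideal_gen (set xs)) K = list_times xs K"
proof
  \<comment> \<open>The ring elements carrying K into \<open>list_times xs K\<close> form an ideal,
    so it is enough to check the generators.\<close>
  have "set xs \<subseteq> {a. \<forall>v\<in>K. scale a v \<in> list_times xs K}"
  proof (induction xs)
    case (Cons x xs)
    have "scale x ` K \<subseteq> list_times (x # xs) K" "list_times xs K \<subseteq> list_times (x # xs) K"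
      using subset_set_plus_left[OF subspace_list_times[OF assms], of "scale x ` K" xs]
        subset_set_plus_right[OF subspace_image_scale[OF assms], of "list_times xs K" x] by auto
    then show ?case using Cons by auto
  qed simp
  moreover have "is_ideal {a. \<forall>v\<in>K. scale a v \<in> list_times xs K}"
    using subspace_list_times[OF assms, of xs] unfolding is_ideal_def
    by (auto simp: subspace_0 subspace_add subspace_scale scale_left_distrib simp flip: scale_scale)
  ultimately have "ideal_gen (set xs) \<subseteq> {a. \<forall>v\<in>K. scale a v \<in> list_times xs K}"
    by (rule ideal_gen_minimal)
  then show "ideal_times scale (ideal_gen (set xs)) K \<subseteq> list_times xs K"
    unfolding ideal_times_def using subspace_list_times[OF assms] by (intro span_minimal) auto
  \<comment> \<open>The induction shortens \<open>ys\<close> while the ideal generated by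
    \<open>xs\<close> stays fixed.\<close>
  have "list_times ys K \<subseteq> ideal_times scale (ideal_gen (set xs)) K" if "set ys \<subseteq> set xs" for ys
    using that
  proof (induction ys)
    case Nil
    then show ?case by (simp add: ideal_times_def span_zero)
  next
    case (Cons y ys)
    have "y \<in> ideal_gen (set xs)" using Cons.prems ideal_gen_superset by force
    then have "scale y ` K \<subseteq> ideal_times scale (ideal_gen (set xs)) K"
      unfolding ideal_times_def by (auto intro!: span_base)
    moreover have "subspace (ideal_times scale (ideal_gen (set xs)) K)" by (simp add: ideal_times_def)
    ultimately show ?case using Cons by (simp add: set_plus_subspace_le)
  qed
  then show "list_times xs K \<subseteq> ideal_times scale (ideal_gen (set xs)) K" by blast
qed

lemma ideal_pow_mod_ideal_gen: "ideal_pow_mod scale (ideal_gen (set xs)) k = list_pow xs k"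
  by (induction k) (simp_all add: ideal_times_ideal_gen subspace_list_pow)

lemma regular_on_append:
  "regular_on N (xs @ ys) \<longleftrightarrow> regular_on N xs \<and> regular_on (N + list_times xs UNIV) ys"
  by (induction xs arbitrary: N) (simp_all add: set_plus_zero add.assoc)

lemma regular_seq_imp_regular_on:
  assumes "regular_seq scale m xs"
  shows "regular_on {0} xs"
proof -
  have "regular_on {0} (take i xs)" if "i \<le> length xs" for i
    using that
  proof (induction i)
    case (Suc i)
    have "nzd (xs ! i) (list_times (take i xs) UNIV)"
      using assms Suc.prems unfolding regular_seq_def nzd_def by (simp add: ideal_times_ideal_gen)
    then show ?case using Suc
      by (simp add: take_Suc_conv_app_nth regular_on_append add.commute[of "{0}"] set_plus_zero)
  qed simp
  from this[of "length xs"] show ?thesis by simp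
qed

section \<open>Annihilators of quotients and chains of primes\<close>

definition quot_ann :: "'b set \<Rightarrow> 'a set" where
  "quot_ann N = {a. \<forall>v. scale a v \<in> N}"

lemma is_ideal_quot_ann: "subspace N \<Longrightarrow> is_ideal (quot_ann N)"
  unfolding is_ideal_def quot_ann_def
  by (auto simp: subspace_0 subspace_add subspace_scale scale_left_distrib simp flip: scale_scale)

lemma power_scale_list_pow:
  assumes "\<And>v. scale a v \<in> list_times xs UNIV"
  shows "scale (a ^ k) v \<in> list_pow xs k"
proof (induction k arbitrary: v)
  case (Suc k)
  have "range (scale (a ^ k)) \<subseteq> list_pow xs k" using Suc by blast
  then have "list_times xs (range (scale (a ^ k))) \<subseteq> list_pow xs (Suc k)"
    by (simp add: list_times_mono)
  moreover have "scale (a ^ k) (scale a v) \<in> list_times xs (range (scale (a ^ k)))"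
    using assms by (simp only: list_times_image imageI)
  ultimately show ?case by (auto simp: mult.commute)
qed simp

text \<open>A regular element does not lie in the minimal primes of the support, so it pushes
  chains of primes up by one step.\<close>

lemma prime_below_regular:
  assumes "noetherian_ring TYPE('a)" "subspace N" "nzd x N"
    and "is_prime_ideal P" "quot_ann (N + range (scale x)) \<subseteq> P"
  shows "\<exists>Q. is_prime_ideal Q \<and> quot_ann N \<subseteq> Q \<and> Q \<subset> P"
proof -
  \<comment> \<open>A prime disjoint from \<open>?S\<close> lies inside \<open>P\<close> (take i =
    0) and omits x (take s = 1). The annihilator of M/N misses \<open>?S\<close> because the powers
    of x cancel modulo N.\<close>
  let ?S = "{x ^ i * s | i s. s \<notin> P}"
  have sub: "N \<subseteq> N + range (scale x)" by (rule subset_set_plus_left[OF subspace_range_scale])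
  have nzd_pow: "v \<in> N" if "scale (x ^ i) v \<in> N" for i v
    using that
  proof (induction i)
    case (Suc i)
    then show ?case using assms(3) by (auto simp: nzd_def simp flip: scale_scale)
  qed simp
  have "quot_ann N \<inter> ?S = {}"
  proof (rule ccontr)
    assume "quot_ann N \<inter> ?S \<noteq> {}"
    then obtain i s where si: "x ^ i * s \<in> quot_ann N" "s \<notin> P" by blast
    then have "scale (x ^ i) (scale s v) \<in> N" for v by (simp add: quot_ann_def)
    then have "scale s v \<in> N" for v using nzd_pow by blast
    then have "s \<in> quot_ann (N + range (scale x))" using sub by (auto simp: quot_ann_def)
    then show False using si assms(5) by blast
  qed
  moreover have "1 \<in> ?S" using is_prime_ideal_one[OF assms(4)] by (force intro: exI[of _ 0])
  moreover have "a * b \<in> ?S" if ab: "a \<in> ?S" "b \<in> ?S" for a b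
  proof -
    obtain i s where a: "a = x ^ i * s" "s \<notin> P" using ab(1) by auto
    obtain j t where b: "b = x ^ j * t" "t \<notin> P" using ab(2) by auto
    have "a * b = x ^ (i + j) * (s * t)"
      unfolding a(1) b(1) power_add by (simp only: mult.assoc mult.commute mult.left_commute)
    moreover have "s * t \<notin> P" using a(2) b(2) assms(4) unfolding is_prime_ideal_def by blast
    ultimately show ?thesis by blast
  qed
  ultimately obtain Q where Q: "is_prime_ideal Q" "quot_ann N \<subseteq> Q" "Q \<inter> ?S = {}"
    using prime_ideal_disjoint_exists[OF assms(1) is_ideal_quot_ann[OF assms(2)], of ?S] by blast
  have "Q \<subseteq> P"
  proof
    fix s assume "s \<in> Q"
    then have "x ^ 0 * s \<notin> ?S" using Q(3) by auto
    then show "s \<in> P" by blast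
  qed
  moreover have "x \<notin> Q"
  proof -
    have "x ^ 1 * 1 \<in> ?S" using is_prime_ideal_one[OF assms(4)] by blast
    then show ?thesis using Q(3) by auto
  qed
  moreover have "x \<in> P"
    using assms(5) subset_set_plus_right[OF assms(2), of "range (scale x)"] by (auto simp: quot_ann_def)
  ultimately show ?thesis using Q by blast
qed

text \<open>The sequence is consumed from its end; each element puts one more prime at the bottom of
  the chain by \<open>prime_below_regular\<close>. This is the inequality between the length of a
  regular sequence and the dimension, in a form that starts from a given chain.\<close>

lemma prime_chain_extend:
  assumes "noetherian_ring TYPE('a)" "subspace N" "regular_on N xs"
    and "\<forall>i\<le>n. is_prime_ideal (P i)" "\<forall>i<n. P i \<subset> P (Suc i)"
    and "quot_ann (N + list_times xs UNIV) \<subseteq> P 0"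
  shows "\<exists>Q :: nat \<Rightarrow> 'a set. (\<forall>i\<le>n + length xs. is_prime_ideal (Q i)) \<and> (\<forall>i<n + length xs. Q i \<subset> Q (Suc i))"
  using assms(3-6)
proof (induction xs arbitrary: n P rule: rev_induct)
  case Nil
  then show ?case by (intro exI[of _ P]) simp
next
  case (snoc x xs)
  let ?L = "N + list_times xs UNIV"
  have reg: "regular_on N xs" "nzd x ?L" using snoc.prems(1) by (auto simp: regular_on_append)
  have sL: "subspace ?L" using assms(2) by (intro subspace_set_plus subspace_list_times) auto
  have "quot_ann (?L + range (scale x)) \<subseteq> P 0"
    using snoc.prems(4) by (simp add: list_times_snoc add.assoc)
  then obtain Q where Q: "is_prime_ideal Q" "quot_ann ?L \<subseteq> Q" "Q \<subset> P 0"
    using prime_below_regular[OF assms(1) sL reg(2), of "P 0"] snoc.prems(2) by blast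
  let ?P = "case_nat Q P"
  have "\<forall>i\<le>Suc n. is_prime_ideal (?P i)"
    using Q(1) snoc.prems(2) by (auto split: nat.split)
  moreover have "\<forall>i<Suc n. ?P i \<subset> ?P (Suc i)"
    using Q(3) snoc.prems(3) by (auto split: nat.split)
  ultimately have "\<exists>Q :: nat \<Rightarrow> 'a set. (\<forall>i\<le>Suc n + length xs. is_prime_ideal (Q i)) \<and>
      (\<forall>i<Suc n + length xs. Q i \<subset> Q (Suc i))"
    using snoc.IH[OF reg(1), of "Suc n" ?P] Q(2) by simp
  then show ?case by simp
qed

end

section \<open>Noetherian local rings\<close>

text \<open>If a is no unit, an ideal maximal among the proper ones containing a is a maximal ideal,
  hence it is m.\<close>

lemma local_ring_unit:
  fixes m :: "'a::comm_ring_1 set"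
  assumes "noetherian_ring TYPE('a)" "local_ring m" "a \<notin> m"
  shows "\<exists>b. b * a = 1"
proof (rule ccontr)
  assume no: "\<nexists>b. b * a = 1"
  let ?F = "{J. is_ideal J \<and> 1 \<notin> J \<and> a \<in> J}"
  have "is_ideal (range ((*) a))"
    unfolding is_ideal_iff_subspace by (rule ring_self.subspace_range_scale)
  moreover have "1 \<notin> range ((*) a)" using no by (metis imageE mult.commute)
  moreover have "a \<in> range ((*) a)" by (rule range_eqI[of _ _ 1]) simp
  ultimately have "range ((*) a) \<in> ?F" by simp
  then have "\<exists>J\<in>?F. \<forall>K\<in>?F. J \<subseteq> K \<longrightarrow> K = J"
    by (intro maximal_ideal_exists[OF assms(1)]) auto
  then obtain J where J: "J \<in> ?F" "\<forall>K\<in>?F. J \<subseteq> K \<longrightarrow> K = J" by (rule bexE)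
  have "K = UNIV" if "is_ideal K" "1 \<in> K" for K
    using is_ideal_mult[OF that] by auto
  then have "is_maximal_ideal J" using J unfolding is_maximal_ideal_def by blast
  then have "J = m" using assms(2) unfolding local_ring_def by blast
  then show False using J(1) assms(3) by blast
qed

section \<open>Nakayama's lemma and the rearrangement of regular sequences\<close>

locale noetherian_local_module = noetherian_module scale
  for scale :: "'a::comm_ring_1 \<Rightarrow> 'b::ab_group_add \<Rightarrow> 'b" +
  fixes m :: "'a set"
  assumes noetherian: "noetherian_ring TYPE('a)" and local_ring: "local_ring m"
begin

lemma is_ideal_m: "is_ideal m" and one_notin_m: "1 \<notin> m"
proof -
  show *: "is_ideal m" using local_ring unfolding local_ring_def is_maximal_ideal_def by blast
  have "m \<noteq> UNIV" using local_ring unfolding local_ring_def is_maximal_ideal_def by blast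
  then show "1 \<notin> m" using is_ideal_mult[OF *, of 1] by auto
qed

lemma is_prime_ideal_m: "is_prime_ideal m"
proof -
  have "y \<in> m" if xy: "x * y \<in> m" and x: "x \<notin> m" for x y
  proof -
    obtain b where "b * x = 1" using local_ring_unit[OF noetherian local_ring x] by blast
    then have "y = b * (x * y)" by (simp flip: mult.assoc)
    then show ?thesis using is_ideal_mult[OF is_ideal_m xy, of b] by simp
  qed
  then show ?thesis using is_ideal_m one_notin_m unfolding is_prime_ideal_def by blast
qed

lemma scale_notin_m:
  assumes "a \<notin> m" "subspace N" "scale a v \<in> N"
  shows "v \<in> N"
proof -
  obtain b where "b * a = 1" using local_ring_unit[OF noetherian local_ring assms(1)] by blast
  then show ?thesis using subspace_scale[OF assms(2,3), of b] by simp
qed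

lemma subset_m_of_proper:
  assumes "is_ideal J" "1 \<notin> J"
  shows "J \<subseteq> m"
proof
  fix a assume a: "a \<in> J"
  show "a \<in> m"
  proof (rule ccontr)
    assume "a \<notin> m"
    then obtain b where "b * a = 1" using local_ring_unit[OF noetherian local_ring] by blast
    then show False using is_ideal_mult[OF assms(1) a, of b] assms(2) by simp
  qed
qed

text \<open>A maximal proper submodule of K containing N takes the place of the usual determinant
  trick.\<close>

lemma nakayama:
  assumes "subspace K" "subspace N" "N \<subseteq> K" "y \<in> m" "K \<subseteq> N + scale y ` K"
  shows "K = N"
proof (rule ccontr)
  assume "K \<noteq> N"
  let ?F = "{L. subspace L \<and> N \<subseteq> L \<and> L \<subset> K}"
  have "N \<in> ?F" using assms \<open>K \<noteq> N\<close> by blast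
  then have "\<exists>L\<in>?F. \<forall>L'\<in>?F. L \<subseteq> L' \<longrightarrow> L' = L"
    by (intro maximal_submodule_exists) auto
  then obtain L where L: "L \<in> ?F" "\<forall>L'\<in>?F. L \<subseteq> L' \<longrightarrow> L' = L" by (rule bexE)
  then have sL: "subspace L" "N \<subseteq> L" "L \<subset> K" by auto
  \<comment> \<open>If \<open>scale y v\<close> were outside \<open>L\<close>, adjoining it would
    give all of K by maximality. Then v = l + ayv, and since 1 - ay is a unit, v and hence
    \<open>scale y v\<close> would lie in \<open>L\<close>.\<close>
  have "scale y v \<in> L" if v: "v \<in> K" for v
  proof (rule ccontr)
    assume yv: "scale y v \<notin> L"
    let ?L' = "L + range (\<lambda>a. scale a (scale y v))"
    have s: "subspace ?L'" using sL subspace_set_plus subspace_range_scale_left by blast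
    have LL': "L \<subseteq> ?L'" by (rule subset_set_plus_left[OF subspace_range_scale_left])
    have "scale y v \<in> ?L'"
      using subset_set_plus_right[OF sL(1)] mem_range_scale_left by blast
    moreover have "?L' \<subseteq> K"
      using v sL assms(1) subspace_scale[OF assms(1)] by (intro set_plus_subspace_le) auto
    ultimately have "?L' = K" using L(2) s LL' sL yv by blast
    then have "v \<in> ?L'" using v by blast
    then obtain l a where la: "l \<in> L" "v = l + scale a (scale y v)" by (auto simp: mem_set_plus)
    have "scale (1 - a * y) v = v - scale a (scale y v)" by (simp add: scale_left_diff_distrib)
    also have "\<dots> = l" using la(2) by (simp add: algebra_simps)
    finally have l: "scale (1 - a * y) v \<in> L" using la(1) by simp
    have "1 - a * y \<notin> m"
      using is_ideal_add[OF is_ideal_m, of "1 - a * y" "a * y"] is_ideal_mult[OF is_ideal_m assms(4), of a]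
        one_notin_m by auto
    then have "v \<in> L" using scale_notin_m sL(1) l by blast
    then show False using yv subspace_scale[OF sL(1)] by blast
  qed
  then have "N + scale y ` K \<subseteq> L" using sL by (intro set_plus_subspace_le) auto
  then show False using assms(5) sL(3) by blast
qed

lemma regular_swap:
  assumes "subspace N" "y \<in> m" "nzd y N" "nzd x (N + range (scale y))"
  shows "nzd x N" "nzd y (N + range (scale x))"
proof -
  let ?K = "{v. scale x v \<in> N}"
  have sK: "subspace ?K" using subspace_vimage_scale[of UNIV N x] assms(1) by simp
  have NK: "N \<subseteq> ?K" using subspace_scale[OF assms(1)] by blast
  have sub: "N \<subseteq> N + range (scale y)" by (rule subset_set_plus_left[OF subspace_range_scale])
  have "?K \<subseteq> N + scale y ` ?K"
  proof
    fix v assume "v \<in> ?K"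
    then have xv: "scale x v \<in> N" by simp
    then have "v \<in> N + range (scale y)" using assms(4) sub by (auto simp: nzd_def)
    then obtain n w where nw: "n \<in> N" "v = n + scale y w" by (auto simp: mem_set_plus)
    have "scale y (scale x w) = scale x v - scale x n"
      by (simp add: nw(2) scale_right_distrib mult.commute)
    also have "\<dots> \<in> N" using xv nw(1) subspace_scale[OF assms(1)] subspace_diff[OF assms(1)] by blast
    finally have "scale x w \<in> N" using assms(3) by (simp only: nzd_def)
    then show "v \<in> N + scale y ` ?K" using nw by (auto simp: mem_set_plus)
  qed
  then have "?K = N" using nakayama[OF sK assms(1) NK assms(2)] by blast
  then show "nzd x N" by (auto simp: nzd_def)
  show "nzd y (N + range (scale x))"
    unfolding nzd_def
  proof (intro allI impI)
    fix v assume "scale y v \<in> N + range (scale x)"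
    then obtain n w where nw: "n \<in> N" "scale y v = n + scale x w" by (auto simp: mem_set_plus)
    have "scale x w = - n + scale y v" using nw(2) by simp
    moreover have "- n \<in> N" using nw(1) subspace_neg[OF assms(1)] by blast
    ultimately have "scale x w \<in> N + range (scale y)" by (metis rangeI set_plus_intro)
    then have "w \<in> N + range (scale y)" using assms(4) by (simp only: nzd_def)
    then obtain n' u where u: "n' \<in> N" "w = n' + scale y u" by (auto simp: mem_set_plus)
    have "scale y (v - scale x u) = n + scale x n'"
      using nw(2) by (simp add: u(2) algebra_simps)
    also have "\<dots> \<in> N" using nw(1) u(1) subspace_scale[OF assms(1)] subspace_add[OF assms(1)] by blast
    finally have "v - scale x u \<in> N" using assms(3) by (simp only: nzd_def)
    moreover have "v = (v - scale x u) + scale x u" by simp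
    ultimately show "v \<in> N + range (scale x)" unfolding mem_set_plus by blast
  qed
qed

text \<open>The last element passes the earlier ones one at a time by
  \<open>regular_swap\<close>.\<close>

lemma regular_on_rotate:
  assumes "subspace N" "set xs \<subseteq> m" "regular_on N (xs @ [x])"
  shows "regular_on N (x # xs)"
  using assms
proof (induction xs arbitrary: N)
  case (Cons y xs)
  let ?N = "N + range (scale y)"
  have sN: "subspace ?N" using Cons.prems(1) subspace_set_plus subspace_range_scale by blast
  have "regular_on ?N (x # xs)" using Cons.IH[OF sN] Cons.prems by simp
  moreover have "?N + range (scale x) = N + range (scale x) + range (scale y)"
    by (simp only: add_ac)
  ultimately show ?case
    using regular_swap[OF Cons.prems(1), of y x] Cons.prems by simp
qed simp

text \<open>Usually read off from the associated graded module being a polynomial extension of M/JM.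
  Here it is a double induction, on the sequence and on k, with N and y arbitrary so that one may
  divide by x and also take x itself for y.\<close>

lemma nzd_list_pow:
  assumes "subspace N" "set xs \<subseteq> m" "regular_on N xs" "nzd y (N + list_times xs UNIV)"
  shows "nzd y (N + list_pow xs k)"
  using assms
proof (induction xs arbitrary: N y k rule: rev_induct)
  case Nil
  have "N + UNIV = UNIV" using subset_set_plus_right[OF Nil.prems(1), of UNIV] by blast
  then have "nzd y (N + UNIV)" by (simp add: nzd_def)
  \<comment> \<open>\<open>list_pow [] k\<close> is \<open>UNIV\<close> for k = 0 and
    \<open>{0}\<close> for all larger k.\<close>
  then show ?case using Nil.prems(4) by (cases k) simp_all
next
  case (snoc x xs)
  let ?L = "list_pow (xs @ [x])" and ?Nx = "N + range (scale x)"
  have m: "set xs \<subseteq> m" using snoc.prems(2) by simp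
  have reg: "regular_on N xs" "nzd x (N + list_times xs UNIV)"
    using snoc.prems(3) by (auto simp: regular_on_append)
  \<comment> \<open>Rotating x to the front keeps \<open>xs\<close> regular after dividing by x, as
    \<open>IHy\<close> requires.\<close>
  have regx: "regular_on ?Nx xs"
    using regular_on_rotate[OF snoc.prems(1) m snoc.prems(3)] by simp
  have sNx: "subspace ?Nx" using snoc.prems(1) subspace_set_plus subspace_range_scale by blast
  have IHx: "nzd x (N + list_pow xs j)" for j
    by (rule snoc.IH[OF snoc.prems(1) m reg])
  have IHy: "nzd y (?Nx + list_pow xs j)" for j
    using snoc.prems(4) by (intro snoc.IH[OF sNx m regx]) (simp add: list_times_snoc add_ac)
  show ?case
  proof (induction k)
    case 0
    have "N + UNIV = UNIV" using subset_set_plus_right[OF snoc.prems(1), of UNIV] by blast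
    then show ?case by (simp add: nzd_def)
  next
    case (Suc k)
    show ?case
      unfolding nzd_def
    proof (intro allI impI)
      fix v assume yv: "scale y v \<in> N + ?L (Suc k)"
      then obtain n0 p0 t where npt: "n0 \<in> N" "p0 \<in> list_pow xs (Suc k)" "t \<in> ?L k"
          "scale y v = n0 + (p0 + scale x t)"
        unfolding list_pow_snoc by (blast elim!: set_plus_elim)
      have "scale y v = (n0 + scale x t) + p0" using npt(4) by (simp add: add_ac)
      then have "scale y v \<in> ?Nx + list_pow xs (Suc k)"
        using npt(1,2) by (metis rangeI set_plus_intro)
      then have "v \<in> ?Nx + list_pow xs (Suc k)" using IHy unfolding nzd_def by blast
      then obtain n w p where nwp: "n \<in> N" "p \<in> list_pow xs (Suc k)" "v = (n + scale x w) + p"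
        by (blast elim!: set_plus_elim)
      have sl: "subspace (list_pow xs (Suc k))" by (rule subspace_list_pow)
      \<comment> \<open>By \<open>IHy\<close>, v is \<open>scale x w\<close> up to N and the power
        of \<open>xs\<close>. Comparing the two expressions for \<open>scale y v\<close> and
        cancelling x with \<open>IHx\<close> puts \<open>scale y w\<close> into
        \<open>N + ?L k\<close>; the inner hypothesis then yields w.\<close>
      have "scale x (scale y w - t) = scale y (scale x w) - scale x t"
        by (simp add: scale_right_diff_distrib mult.commute)
      also have "\<dots> = (n0 - scale y n) + (p0 - scale y p)"
        using npt(4) unfolding nwp(3) by (simp add: algebra_simps)
      also have "\<dots> \<in> N + list_pow xs (Suc k)"
        using npt(1,2) nwp(1,2) subspace_diff subspace_scale snoc.prems(1) sl
        by (intro set_plus_intro) blast+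
      finally have "scale y w - t \<in> N + list_pow xs (Suc k)" using IHx unfolding nzd_def by blast
      moreover have "list_pow xs (Suc k) \<subseteq> ?L k"
        using list_pow_Suc_subset list_pow_subset_snoc by blast
      ultimately obtain n1 q where nq: "n1 \<in> N" "q \<in> ?L k" "scale y w - t = n1 + q"
        by (blast elim!: set_plus_elim)
      have "scale y w = n1 + (q + t)" using nq(3) by (simp add: algebra_simps)
      moreover have "q + t \<in> ?L k" using nq(2) npt(3) subspace_add[OF subspace_list_pow] by blast
      ultimately have "scale y w \<in> N + ?L k" using nq(1) by (metis set_plus_intro)
      then have "w \<in> N + ?L k" using Suc unfolding nzd_def by blast
      then obtain n2 u where u: "n2 \<in> N" "u \<in> ?L k" "w = n2 + u" by (blast elim!: set_plus_elim)
      have "v = (n + scale x n2) + (p + scale x u)"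
        unfolding nwp(3) u(3) by (simp add: algebra_simps)
      moreover have "n + scale x n2 \<in> N"
        using nwp(1) u(1) snoc.prems(1) subspace_add subspace_scale by blast
      moreover have "p + scale x u \<in> ?L (Suc k)"
        unfolding list_pow_snoc using nwp(2) u(2) by (intro set_plus_intro) blast+
      ultimately show "v \<in> N + ?L (Suc k)" by (metis set_plus_intro)
    qed
  qed
qed

text \<open>\<open>list_pow_snoc\<close> gives xv = p + xw with p free of x and w of degree k. By
  \<open>nzd_list_pow\<close>, x can be cancelled from x(v - w) = p.\<close>

lemma list_pow_colon_last:
  assumes "set xs \<subseteq> m" "regular_on {0} (xs @ [x])" "scale x v \<in> list_pow (xs @ [x]) (Suc k)"
  shows "v \<in> list_pow (xs @ [x]) k"
proof -
  have zero: "{0} + A = A" for A :: "'b set" by (simp add: add.commute[of "{0}"] set_plus_zero)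
  have "nzd x ({0} + list_pow xs (Suc k))"
    using assms(1,2) by (intro nzd_list_pow) (auto simp: regular_on_append)
  then have nzd: "nzd x (list_pow xs (Suc k))" by (simp only: zero)
  obtain p w where pw: "p \<in> list_pow xs (Suc k)" "w \<in> list_pow (xs @ [x]) k" "scale x v = p + scale x w"
    using assms(3) unfolding list_pow_snoc by (blast elim!: set_plus_elim)
  then have "scale x (v - w) = p" by (simp add: scale_right_diff_distrib)
  then have "v - w \<in> list_pow xs (Suc k)" using nzd pw(1) unfolding nzd_def by blast
  then have "v - w \<in> list_pow (xs @ [x]) k" using list_pow_Suc_subset list_pow_subset_snoc by blast
  then have "(v - w) + w \<in> list_pow (xs @ [x]) k" using pw(2) subspace_add[OF subspace_list_pow] by blast
  then show ?thesis by simp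
qed

text \<open>Each new element is found by prime avoidance at the end of the given regular sequence and
  then rotated to its front, so that what remains is again a regular sequence.\<close>

lemma regular_generators_exist:
  assumes "subspace N" "set ys \<subseteq> m" "regular_on N ys" "length as = Suc (length ys)"
    and "X \<subseteq> quot_ann N" "\<And>a. a \<in> m \<Longrightarrow> \<exists>n. a ^ n \<in> ideal_gen (X \<union> set as)"
  shows "\<exists>xs z. length xs = length ys \<and> regular_on N xs \<and>
    ideal_gen (X \<union> set (xs @ [z])) = ideal_gen (X \<union> set as)"
  using assms
proof (induction ys arbitrary: N X as rule: rev_induct)
  case Nil
  then obtain z where "as = [z]" by (auto simp: length_Suc_conv)
  then show ?case by (intro exI[of _ "[]"] exI[of _ z]) simp
next
  case (snoc y ys)
  obtain a as' where as: "as = a # as'" "length as' = Suc (length ys)"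
    using snoc.prems(4) by (cases as) auto
  let ?L = "N + list_times ys UNIV"
  have sL: "subspace ?L" using snoc.prems(1) by (intro subspace_set_plus subspace_list_times) auto
  have reg: "regular_on N ys" "nzd y ?L" using snoc.prems(3) by (auto simp: regular_on_append)
  have NL: "N \<subseteq> ?L" by (rule subset_set_plus_left) (simp add: subspace_list_times)
  \<comment> \<open>Such a \<open>P\<close> would contain \<open>X\<close>, which annihilates M/N,
    and all of \<open>as\<close>. A power of y lies in the ideal they generate, so y would be in
    \<open>P\<close>, although y is regular modulo \<open>?L\<close>.\<close>
  have "\<not> insert a (ideal_gen (set as')) \<subseteq> P" if P: "P \<in> ass ?L" for P
  proof
    assume "insert a (ideal_gen (set as')) \<subseteq> P"
    then have "set as \<subseteq> P" using ideal_gen_superset[of "set as'"] as(1) by auto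
    moreover have "X \<subseteq> P"
      using snoc.prems(5) NL P unfolding quot_ann_def ass_def colon_def by blast
    moreover have pP: "is_prime_ideal P" using P unfolding ass_def by blast
    ultimately have "ideal_gen (X \<union> set as) \<subseteq> P"
      by (intro ideal_gen_minimal) (auto simp: is_prime_ideal_def)
    moreover obtain n where "y ^ n \<in> ideal_gen (X \<union> set as)" using snoc.prems(2,6) by auto
    ultimately have "y \<in> P" using is_prime_ideal_power[OF pP] by blast
    then show False using nzd_notin_ass[OF reg(2) P] by blast
  qed
  then have "\<exists>b\<in>ideal_gen (set as'). \<forall>P\<in>ass ?L. a + b \<notin> P"
    using finite_ass[OF noetherian sL] is_ideal_ideal_gen
    by (intro coset_prime_avoidance) (auto simp: ass_def)
  then obtain b where b: "b \<in> ideal_gen (set as')" "\<forall>P\<in>ass ?L. a + b \<notin> P" by blast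
  let ?x = "a + b" and ?N = "N + range (scale (a + b))"
  have "nzd ?x ?L" using not_nzd_imp_ass[OF noetherian sL] b(2) by blast
  then have "regular_on N (ys @ [?x])" using reg(1) by (simp add: regular_on_append)
  then have reg': "nzd ?x N" "regular_on ?N ys"
    using regular_on_rotate[OF snoc.prems(1), of ys ?x] snoc.prems(2) by simp_all
  have sN: "subspace ?N" using snoc.prems(1) subspace_set_plus subspace_range_scale by blast
  \<comment> \<open>Since b comes from the remaining generators, replacing a by \<open>?x\<close>
    keeps the ideal. The new element moves into \<open>X\<close>, which collects the elements
    already chosen.\<close>
  have gen: "ideal_gen (insert ?x X \<union> set as') = ideal_gen (X \<union> set as)" (is "?I = ?J")
  proof
    have iI: "is_ideal ?I" and iJ: "is_ideal ?J" by (rule is_ideal_ideal_gen)+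
    have I: "insert ?x X \<union> set as' \<subseteq> ?I" and J: "X \<union> set as \<subseteq> ?J" by (rule ideal_gen_superset)+
    have "set as' \<subseteq> ?I" "set as' \<subseteq> ?J" using I J as(1) by auto
    then have "ideal_gen (set as') \<subseteq> ?I" "ideal_gen (set as') \<subseteq> ?J"
      using ideal_gen_minimal iI iJ by blast+
    then have b': "b \<in> ?I" "b \<in> ?J" using b(1) by blast+
    have "?x \<in> ?I" "a \<in> ?J" using I J as(1) by auto
    then have "a \<in> ?I" "?x \<in> ?J"
      using is_ideal_add_cancel[OF iI b'(1)] is_ideal_add_cancel[OF iJ b'(2)] by blast+
    then have "insert ?x X \<union> set as' \<subseteq> ?J" "X \<union> set as \<subseteq> ?I" using I J as(1) by auto
    then show "?I \<subseteq> ?J" "?J \<subseteq> ?I" using ideal_gen_minimal iI iJ by blast+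
  qed
  have "insert ?x X \<subseteq> quot_ann ?N"
    using snoc.prems(5) subset_set_plus_left[OF subspace_range_scale[of ?x], of N]
      subset_set_plus_right[OF snoc.prems(1), of "range (scale ?x)"]
    unfolding quot_ann_def by blast
  then have "\<exists>xs z. length xs = length ys \<and> regular_on ?N xs \<and>
      ideal_gen (insert ?x X \<union> set (xs @ [z])) = ideal_gen (insert ?x X \<union> set as')"
    using snoc.prems(2,6) gen by (intro snoc.IH[OF sN _ reg'(2) as(2)]) auto
  then obtain xs z where xs: "length xs = length ys" "regular_on ?N xs"
      "ideal_gen (insert ?x X \<union> set (xs @ [z])) = ideal_gen (X \<union> set as)"
    unfolding gen by blast
  have "insert ?x X \<union> set (xs @ [z]) = X \<union> set ((?x # xs) @ [z])" by auto
  then show ?case using xs reg'(1)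
    by (intro exI[of _ "?x # xs"] exI[of _ z]) simp
qed

section \<open>Finite length modulo a regular sequence as long as the dimension\<close>

lemma mod_length_step:
  assumes "subspace N" "\<And>a. a \<in> m \<Longrightarrow> scale a v \<in> N"
  shows "mod_length scale (N + range (\<lambda>a. scale a v)) N \<le> 1"
proof (rule mod_length_leI)
  let ?L = "N + range (\<lambda>a. scale a v)"
  \<comment> \<open>The quotient \<open>?L\<close>/N is zero or the residue field: a submodule
    strictly above N contains some av with a a unit, hence v.\<close>
  have full: "C = ?L" if C: "subspace C" "N \<subset> C" "C \<subseteq> ?L" for C
  proof -
    obtain w where w: "w \<in> C" "w \<notin> N" using C(2) by blast
    then obtain n a where na: "n \<in> N" "w = n + scale a v" using C(3) by (blast elim!: set_plus_elim)
    have "a \<notin> m" using na w(2) assms(2) subspace_add[OF assms(1)] by blast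
    moreover have "scale a v = w - n" using na(2) by simp
    then have "scale a v \<in> C" using w(1) na(1) C(2) subspace_diff[OF C(1)] by auto
    ultimately have "v \<in> C" using scale_notin_m C(1) by blast
    then have "?L \<subseteq> C" using C(1,2) subspace_scale[OF C(1)] by (intro set_plus_subspace_le) auto
    then show ?thesis using C(3) by blast
  qed
  fix k assume k: "schain k N ?L"
  show "enat k \<le> 1"
  proof (rule ccontr)
    assume "\<not> enat k \<le> 1"
    then obtain j where j: "k = Suc (Suc j)"
      by (metis One_nat_def enat_ord_simps(1) not0_implies_Suc not_less_eq_eq one_enat_def zero_le)
    from k[unfolded j] obtain K where K: "schain (Suc j) N K" "K \<subset> ?L" by cases auto
    from K(1) obtain K' where K': "schain j N K'" "K' \<subset> K" "subspace K" by cases auto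
    have "N \<subset> K" using schain_subspace(3)[OF K'(1)] K'(2) by blast
    then show False using full[OF K'(3)] K(2) by blast
  qed
qed

text \<open>Noetherian induction. An associated prime \<open>colon N v\<close> contains a power of
  every element of m, hence m itself, so adjoining v adds at most one to the length. The hypothesis
  passes to larger submodules.\<close>

lemma mod_length_finite:
  assumes "subspace N" "\<And>a. a \<in> m \<Longrightarrow> \<exists>n. a ^ n \<in> quot_ann N"
  shows "mod_length scale UNIV N \<noteq> \<infinity>"
proof -
  have "(\<forall>a\<in>m. \<exists>n. a ^ n \<in> quot_ann N) \<longrightarrow> mod_length scale UNIV N \<noteq> \<infinity>"
    using assms(1)
  proof (rule noetherian_induct, intro impI)
    fix N
    assume less: "subspace N"
        "\<And>K. subspace K \<Longrightarrow> N \<subset> K \<Longrightarrow>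
          (\<forall>a\<in>m. \<exists>n. a ^ n \<in> quot_ann K) \<longrightarrow> mod_length scale UNIV K \<noteq> \<infinity>"
      and nil: "\<forall>a\<in>m. \<exists>n. a ^ n \<in> quot_ann N"
    show "mod_length scale UNIV N \<noteq> \<infinity>"
    proof (cases "N = UNIV")
      case True
      have "mod_length scale UNIV UNIV \<le> 0"
      proof (rule mod_length_leI)
        fix k assume "schain k (UNIV :: 'b set) UNIV"
        then show "enat k \<le> 0" by cases (auto dest: schain_subspace simp: zero_enat_def)
      qed
      then show ?thesis using True by simp
    next
      case False
      then obtain v where v: "v \<notin> N" "colon N v \<in> ass N" using ass_above_colon[OF noetherian less(1)] by blast
      have "a \<in> colon N v" if "a \<in> m" for a
      proof -
        obtain n where "a ^ n \<in> quot_ann N" using nil \<open>a \<in> m\<close> by blast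
        then have "a ^ n \<in> colon N v" by (simp add: quot_ann_def colon_def)
        then show ?thesis using v(2) is_prime_ideal_power unfolding ass_def by blast
      qed
      then have mv: "\<And>a. a \<in> m \<Longrightarrow> scale a v \<in> N" by (simp add: colon_def)
      let ?L = "N + range (\<lambda>a. scale a v)"
      have sL: "subspace ?L" using less(1) subspace_set_plus subspace_range_scale_left by blast
      have NL: "N \<subseteq> ?L" by (rule subset_set_plus_left[OF subspace_range_scale_left])
      moreover have "v \<in> ?L" using subset_set_plus_right[OF less(1)] mem_range_scale_left by blast
      ultimately have "N \<subset> ?L" using v(1) by blast
      moreover have "\<exists>n. a ^ n \<in> quot_ann ?L" if "a \<in> m" for a
        using nil that NL unfolding quot_ann_def by blast
      ultimately have "mod_length scale UNIV ?L \<noteq> \<infinity>" using less(2)[OF sL] by blast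
      moreover have "mod_length scale ?L N \<noteq> \<infinity>" using mod_length_step[OF less(1) mv] by (metis enat_ord_simps(5) infinity_ne_i1)
      moreover have "mod_length scale UNIV N \<le> mod_length scale UNIV ?L + mod_length scale ?L N"
        using sL NL by (intro mod_length_le_add) auto
      ultimately show ?thesis by (metis enat_ord_simps(5) plus_eq_infty_iff_enat)
    qed
  qed
  then show ?thesis using assms(2) by blast
qed

text \<open>Otherwise some prime P above the annihilator of M/JM, with J generated by
  \<open>xs\<close>, omits the powers of a. Then P < m is a chain of length one, and
  \<open>prime_chain_extend\<close> lengthens it beyond the dimension.\<close>

lemma nilpotent_mod_maximal_regular_sequence:
  assumes "krull_dim TYPE('a) = enat (length xs)" "regular_on {0} xs" "a \<in> m"
  shows "\<exists>n. a ^ n \<in> quot_ann (list_times xs UNIV)"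
proof (rule ccontr)
  assume no: "\<nexists>n. a ^ n \<in> quot_ann (list_times xs UNIV)"
  let ?A = "quot_ann (list_times xs UNIV)"
  have iA: "is_ideal ?A" by (rule is_ideal_quot_ann) (simp add: subspace_list_times)
  have "\<exists>P. is_prime_ideal P \<and> ?A \<subseteq> P \<and> P \<inter> range (\<lambda>n. a ^ n) = {}"
    by (rule prime_ideal_disjoint_exists[OF noetherian iA])
      (use no in \<open>auto simp flip: power_add intro: range_eqI[of _ _ 0]\<close>)
  then obtain P where P: "is_prime_ideal P" "?A \<subseteq> P" "P \<inter> range (\<lambda>n. a ^ n) = {}" by blast
  have "a ^ 1 \<notin> P" using P(3) by blast
  then have "P \<subset> m"
    using subset_m_of_proper[of P] is_prime_ideal_one[OF P(1)] P(1) assms(3)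
    by (auto simp: is_prime_ideal_def)
  let ?P = "\<lambda>i. if i = 0 then P else m"
  have "\<exists>Q :: nat \<Rightarrow> 'a set. (\<forall>i\<le>1 + length xs. is_prime_ideal (Q i)) \<and> (\<forall>i<1 + length xs. Q i \<subset> Q (Suc i))"
    by (rule prime_chain_extend[OF noetherian _ assms(2), of 1 ?P])
      (use P(1,2) \<open>P \<subset> m\<close> is_prime_ideal_m in \<open>auto simp: add.commute[of "{0}"] set_plus_zero\<close>)
  then have "enat (1 + length xs) \<le> krull_dim TYPE('a)"
    unfolding krull_dim_def by (intro Sup_upper) blast
  then show False using assms(1) by simp
qed

section \<open>Comparison of consecutive Hilbert function values for suitable generators\<close>

lemma hilbert_fun_le_Suc:
  assumes "krull_dim TYPE('a) = enat (Suc (length xs))" "set xs \<subseteq> m" "regular_on {0} (xs @ [x])"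
    and "I = ideal_gen (set ((xs @ [x]) @ [z]))"
  shows "hilbert_fun scale I k \<le> hilbert_fun scale I (Suc k)"
proof -
  let ?J = "list_pow (xs @ [x])" and ?I = "list_pow ((xs @ [x]) @ [z])"
  \<comment> \<open>Modulo \<open>?J (Suc k)\<close>, this is the kernel of z on the finite length
    module \<open>?I k\<close>/\<open>?J (Suc k)\<close>.\<close>
  define K where "K k = {v \<in> ?I k. scale z v \<in> ?J (Suc k)}" for k
  have JI: "?J (Suc k) \<subseteq> ?I k" for k
    using list_pow_Suc_subset list_pow_subset_snoc by blast
  have sK: "subspace (K k)" for k
    unfolding K_def by (intro subspace_vimage_scale subspace_list_pow)
  have fin: "mod_length scale (?I k) (?J (Suc k)) \<noteq> \<infinity>" for k
  proof -
    have "mod_length scale UNIV (?J (Suc k)) \<noteq> \<infinity>"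
    proof (rule mod_length_finite[OF subspace_list_pow])
      fix a assume "a \<in> m"
      then obtain n where "a ^ n \<in> quot_ann (list_times (xs @ [x]) UNIV)"
        using nilpotent_mod_maximal_regular_sequence[of "xs @ [x]" a] assms(1,3) by auto
      \<comment> \<open>If \<open>a ^ n\<close> carries M into JM, its power of exponent k + 1
        carries M into J^(k+1) M.\<close>
      then have "scale ((a ^ n) ^ Suc k) v \<in> ?J (Suc k)" for v
        by (intro power_scale_list_pow) (simp add: quot_ann_def)
      then have "a ^ (n * Suc k) \<in> quot_ann (?J (Suc k))"
        unfolding quot_ann_def power_mult by blast
      then show "\<exists>n. a ^ n \<in> quot_ann (?J (Suc k))" by blast
    qed
    moreover have "mod_length scale (?I k) (?J (Suc k)) \<le> mod_length scale UNIV (?J (Suc k))"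
      using JI by (intro mod_length_mono subspace_list_pow) auto
    ultimately show ?thesis by (metis enat_ord_simps(5))
  qed
  \<comment> \<open>\<open>list_pow_snoc\<close> for z identifies the quotient defining the Hilbert
    function with the cokernel of z; its length is that of the kernel.\<close>
  have H: "hilbert_fun scale I k = mod_length scale (K k) (?J (Suc k))" for k
  proof -
    have "hilbert_fun scale I k = mod_length scale (?I k) (scale z ` ?I k + ?J (Suc k))"
      unfolding hilbert_fun_def assms(4) ideal_pow_mod_ideal_gen list_pow_snoc[of "xs @ [x]" z k]
      by (simp only: add.commute)
    also have "\<dots> = mod_length scale (K k) (?J (Suc k))"
      unfolding K_def using JI fin subspace_scale[OF subspace_list_pow]
      by (intro mod_length_coker_eq_ker subspace_list_pow) blast+
    finally show ?thesis .
  qed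
  have "mod_length scale (K k) (?J (Suc k)) \<le> mod_length scale (K (Suc k)) (?J (Suc (Suc k)))"
  proof (rule mod_length_ker_le[where x = x])
    have JK: "?J (Suc k) \<subseteq> K k" for k
      unfolding K_def using JI subspace_scale[OF subspace_list_pow] by blast
    show "?J (Suc k) \<subseteq> K k" "?J (Suc (Suc k)) \<subseteq> K (Suc k)" by (rule JK)+
    \<comment> \<open>As x is one of the generators of J and of I, it raises both degrees by one,
      and it commutes with z.\<close>
    show "scale x ` K k \<subseteq> K (Suc k)"
    proof
      fix u assume "u \<in> scale x ` K k"
      then obtain v where v: "u = scale x v" "v \<in> ?I k" "scale z v \<in> ?J (Suc k)"
        unfolding K_def by blast
      have "u \<in> list_times (xs @ [x]) (?I k)"
        using v(1,2) subset_set_plus_right[OF subspace_list_times[OF subspace_list_pow]]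
        unfolding list_times_snoc by blast
      then have "u \<in> ?I (Suc k)"
        using list_times_subset_snoc[OF subspace_list_pow, of "xs @ [x]" "(xs @ [x]) @ [z]" k z] by auto
      moreover have "scale z u = scale x (scale z v)" using v(1) by (simp add: mult.commute)
      then have "scale z u \<in> ?J (Suc (Suc k))" using v(3) list_pow_scale_subset by blast
      ultimately show "u \<in> K (Suc k)" unfolding K_def by blast
    qed
    \<comment> \<open>One direction makes the induced map on the kernels well defined, the other
      makes it injective.\<close>
    show "scale x v \<in> ?J (Suc (Suc k)) \<longleftrightarrow> v \<in> ?J (Suc k)" for v
      using list_pow_colon_last[OF assms(2,3)] list_pow_scale_subset by blast
  qed (intro sK subspace_list_pow)+
  then show ?thesis unfolding H .
qed

end

section \<open>Choice of the generators and monotonicity of the Hilbert function\<close>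

theorem theorem3p6:
  fixes m :: "'a::comm_ring_1 set" and sc :: "'a \<Rightarrow> 'm::ab_group_add \<Rightarrow> 'm"
    and I :: "'a set" and d :: nat
  assumes "noetherian_ring TYPE('a)"
    and "local_ring m"
    and "equicharacteristic m"
    and "krull_dim TYPE('a) = enat d" and "d > 0"
    and "module sc" and "fin_gen_module sc"
    and "depth sc m = enat d"
    and "m_primary m I"
    and "mu I = d + 1"
  shows "mono (hilbert_fun sc I)"
proof -
  interpret module sc by fact
  interpret scalar_module sc ..
  interpret noetherian_module sc using assms(1,7) by (rule noetherian_moduleI)
  interpret noetherian_local_module sc m using assms(1,2) by unfold_locales
  have idl: "is_ideal I" and rad: "radical I = m"
    using assms(9) by (auto simp: m_primary_def primary_ideal_def)
  have "\<exists>S. finite S \<and> card S = mu I \<and> ideal_gen S = I"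
  proof -
    obtain S where "finite S" "ideal_gen S = I"
      using assms(1) idl unfolding noetherian_ring_def by metis
    then have "\<exists>n S. finite S \<and> card S = n \<and> ideal_gen S = I" by blast
    then show ?thesis unfolding mu_def by (rule LeastI_ex)
  qed
  then obtain S where S: "finite S" "card S = Suc d" "ideal_gen S = I" using assms(10) by auto
  then obtain as where as: "set as = S" "length as = Suc d"
    using finite_distinct_list[OF S(1)] by (metis distinct_card)
  have "\<exists>ys. regular_seq sc m ys \<and> length ys = d"
  proof -
    let ?X = "{enat (length xs) | xs. regular_seq sc m xs}"
    have X: "Sup ?X = enat d" using assms(8) unfolding depth_def .
    have ne: "?X \<noteq> {}"
    proof
      \<comment> \<open>The supremum of the empty set in \<open>enat\<close> is 0, which
        \<open>d > 0\<close> excludes; hence the depth is attained by some sequence.\<close>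
      assume "?X = {}"
      then show False using X assms(5) by (simp add: bot_enat_def zero_enat_def)
    qed
    have "finite ?X" "Max ?X = enat d" using X ne unfolding Sup_enat_def by (metis enat.distinct(1))+
    then have "enat d \<in> ?X" using Max_in[OF _ ne] by metis
    then show ?thesis by auto
  qed
  then obtain ys where ys: "regular_seq sc m ys" "length ys = d" by blast
  \<comment> \<open>The construction starts with no element chosen and N = 0; every element of m has
    a power in I because the radical of I is m.\<close>
  have "\<exists>xs z. length xs = length ys \<and> regular_on {0} xs \<and>
      ideal_gen ({} \<union> set (xs @ [z])) = ideal_gen ({} \<union> set as)"
  proof (rule regular_generators_exist)
    show "set ys \<subseteq> m" using ys(1) by (simp add: regular_seq_def)
    show "regular_on {0} ys" using ys(1) by (rule regular_seq_imp_regular_on)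
    show "\<exists>n. a ^ n \<in> ideal_gen ({} \<union> set as)" if "a \<in> m" for a
      using that rad S(3) as(1) by (auto simp: radical_def)
  qed (use ys(2) as(2) in auto)
  then obtain xs z where xs: "length xs = d" "regular_on {0} xs" "I = ideal_gen (set (xs @ [z]))"
    using ys(2) as(1) S(3) by auto
  moreover have "I \<subseteq> m" using rad unfolding radical_def by (auto intro: exI[of _ 1])
  ultimately have xm: "set xs \<subseteq> m" using ideal_gen_superset[of "set (xs @ [z])"] by auto
  \<comment> \<open>Positive dimension provides a last regular element, by which consecutive kernels
    are compared.\<close>
  obtain xs' x where x: "xs = xs' @ [x]" using xs(1) assms(5) by (cases xs rule: rev_cases) auto
  have "hilbert_fun sc I k \<le> hilbert_fun sc I (Suc k)" for k
    using xs xm assms(4) unfolding x by (intro hilbert_fun_le_Suc[of xs' x I z]) auto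
  then show ?thesis by (simp add: mono_iff_le_Suc)
qed

end
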